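(* Let $p$ be a prime, $k$ the finite field with $p$ elements, $K=k(\!(T)\!)$, and let $x=(f_0(T),f_1(T),\dots)\in W(K)^\times$. Then there exist $c\in k^\times$, elements $c_{jk}\in k$ (for integers $k\ge0$ and positive integers $j$ with $(j,p)=1$), and integers $k_{i_1,i_2}\in\{0,1,\dots,p-1\}$ (for integers $i_2\ge2$ and integers $i_1$ bounded below, the bound depending on $i_2$) such that $$x=[cT^d]\cdot\prod_{k=0}^\infty\prod_{(j,p)=1}[1-c_{jk}T^j]^{p^k}\cdot\prod_{i_2=2}^\infty\prod_{i_1}u_{i_1,i_2}^{k_{i_1,i_2}},$$ where $d=v_T(f_0(T))$ and the infinite products converge componentwise $T$-adically in $W(K)^\times$.
   Context: $W(K)$ is the ring of $p$-typical Witt vectors over $K$, $W(K)^\times$ its unit group, $[\,\cdot\,]$ the Teichmüller lift, $V$ the Verschiebung $V(x_0,x_1,\dots)=(0,x_0,x_1,\dots)$, and for integers $m$ and $n\ge2$, $u_{m,n}=1+V^{n-1}[T^m]\in W(K)^\times$ (so its truncation to length $n$ is $(1,0,\dots,0,T^m)$). $v_T$ is the $T$-adic valuation on $K$. *)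

theory Defs
  imports
    "HOL-Algebra.Ring"
    "HOL-Library.Cardinality"
    "HOL-Library.Poly_Mapping"
    "HOL-Computational_Algebra.Formal_Laurent_Series"
begin

definition ghost :: "nat \<Rightarrow> (nat \<Rightarrow> 'a::comm_semiring_1) \<Rightarrow> nat \<Rightarrow> 'a" where
  "ghost p x n = (\<Sum>i\<le>n. of_nat (p ^ i) * x i ^ (p ^ (n - i)))"

text \<open>
  The integral polynomial ring in two sequences of indeterminates: \<open>Inl i\<close> is the index of
  \<open>X\<^sub>i\<close> and \<open>Inr i\<close> that of \<open>Y\<^sub>i\<close>; monomials are finitely supported exponent functions.
\<close>

type_synonym xy_poly = "((nat + nat) \<Rightarrow>\<^sub>0 nat) \<Rightarrow>\<^sub>0 int"

definition xy_var :: "nat + nat \<Rightarrow> xy_poly" where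
  "xy_var v = Poly_Mapping.single (Poly_Mapping.single v 1) 1"

definition xy_eval :: "(nat + nat \<Rightarrow> 'a::comm_ring_1) \<Rightarrow> xy_poly \<Rightarrow> 'a" where
  "xy_eval s P =
     (\<Sum>m\<in>Poly_Mapping.keys P. of_int (Poly_Mapping.lookup P m) *
        (\<Prod>v\<in>Poly_Mapping.keys m. s v ^ Poly_Mapping.lookup m v))"

text \<open>
  For prime \<open>p\<close> the following are the unique sequences of integral polynomials whose ghost
  components are the sums, respectively the products, of the ghost components of \<open>X\<close> and \<open>Y\<close>.
\<close>

definition witt_add_poly :: "nat \<Rightarrow> nat \<Rightarrow> xy_poly" where
  "witt_add_poly p =
     (THE S. \<forall>n. ghost p S n =
        ghost p (\<lambda>i. xy_var (Inl i)) n + ghost p (\<lambda>i. xy_var (Inr i)) n)"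

definition witt_mult_poly :: "nat \<Rightarrow> nat \<Rightarrow> xy_poly" where
  "witt_mult_poly p =
     (THE M. \<forall>n. ghost p M n =
        ghost p (\<lambda>i. xy_var (Inl i)) n * ghost p (\<lambda>i. xy_var (Inr i)) n)"

definition witt_ring :: "nat \<Rightarrow> (nat \<Rightarrow> 'a::comm_ring_1) ring" where
  "witt_ring p =
     \<lparr>carrier = UNIV,
      monoid.mult = (\<lambda>x y n. xy_eval (case_sum x y) (witt_mult_poly p n)),
      one = (\<lambda>n. if n = 0 then 1 else 0),
      zero = (\<lambda>n. 0),
      add = (\<lambda>x y n. xy_eval (case_sum x y) (witt_add_poly p n))\<rparr>"

definition teichmueller :: "'a::comm_ring_1 \<Rightarrow> nat \<Rightarrow> 'a" where
  "teichmueller a = (\<lambda>n. if n = 0 then a else 0)"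

definition verschiebung :: "(nat \<Rightarrow> 'a::comm_ring_1) \<Rightarrow> nat \<Rightarrow> 'a" where
  "verschiebung x = (\<lambda>n. case n of 0 \<Rightarrow> 0 | Suc i \<Rightarrow> x i)"

definition witt_u :: "nat \<Rightarrow> int \<Rightarrow> nat \<Rightarrow> nat \<Rightarrow> 'k::field fls" where
  "witt_u p m n =
     \<one>\<^bsub>witt_ring p\<^esub> \<oplus>\<^bsub>witt_ring p\<^esub> (verschiebung ^^ (n - 1)) (teichmueller (fls_X powi m))"

text \<open>
  Convergence of a product in the unit group, as a limit of the net of finite partial products.
  The topology on \<open>'k fls\<close> is the library's, whose metric is the \<open>T\<close>-adic one.
\<close>

definition witt_has_prod ::
  "nat \<Rightarrow> ('i \<Rightarrow> nat \<Rightarrow> 'k::field fls) \<Rightarrow> 'i set \<Rightarrow> (nat \<Rightarrow> 'k fls) \<Rightarrow> bool" where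
  "witt_has_prod p f I x \<longleftrightarrow>
     f ` I \<subseteq> Units (witt_ring p) \<and> x \<in> Units (witt_ring p) \<and>
     (\<forall>n. ((\<lambda>F. finprod (witt_ring p) f F n) \<longlongrightarrow> x n) (finite_subsets_at_top I))"

end

theory Submission
  imports
    Defs
    "HOL-Number_Theory.Residues"
    "HOL-Analysis.Elementary_Metric_Spaces"
begin

unbundle fps_syntax

text \<open>
  The Teichmueller lift of the leading component splits off: \<open>x = [f\<^sub>0] y\<close> with \<open>y \<in> 1 + V W(K)\<close>.
  Writing \<open>f\<^sub>0 = c T\<^sup>d g\<close> with \<open>g \<equiv> 1\<close> mod \<open>T\<close>, one expands \<open>g = \<Prod>\<^sub>n (1 - a\<^sub>n T\<^sup>n)\<close> greedily; for
  \<open>n = j p\<^sup>k\<close> with \<open>j\<close> prime to \<open>p\<close> the \<open>n\<close>-th factor equals \<open>(1 - a\<^sub>n T\<^sup>j)\<close> to the power \<open>p\<^sup>k\<close>,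
  since \<open>a\<^sup>p = a\<close> in the prime field. All of this happens in \<open>K\<close>, because the Teichmueller lift is
  multiplicative and continuous.

  On \<open>1 + V\<^sup>m W(K)\<close>, \<open>m \<ge> 1\<close>, multiplication is addition in the component with index \<open>m\<close>, where
  \<open>1 + V\<^sup>m [T\<^sup>i]\<close> has entry \<open>T\<^sup>i\<close>. So a suitable product of the \<open>u\<^bsub>i,m+1\<^esub>\<close> matches that component of
  \<open>y\<close>, the quotient lies in \<open>1 + V\<^sup>m\<^sup>+\<^sup>1 W(K)\<close>, and one iterates.

  Convergence rests on one observation: the Witt polynomials have integer coefficients, so
  multiplication of Witt vectors with components in \<open>k[[T]]\<close> respects componentwise congruence
  modulo \<open>T\<^sup>N\<close>.
\<close>


section \<open>Congruences modulo powers of a prime\<close>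

lemma prime_dvd_add_power_diff:
  fixes a b :: "'a::comm_ring_1"
  assumes "prime p"
  shows "of_nat p dvd (a + b) ^ p - (a ^ p + b ^ p)"
proof -
  have p: "p > 0"
    using assms prime_gt_0_nat by blast
  let ?g = "\<lambda>k. of_nat (p choose k) * a ^ k * b ^ (p - k)"
  have "(a + b) ^ p = (\<Sum>k\<le>p. ?g k)"
    by (rule binomial_ring)
  also have "{..p} = insert 0 (insert p {0<..<p})"
    using p by auto
  also have "sum ?g \<dots> = b ^ p + (a ^ p + sum ?g {0<..<p})"
    using p by simp
  finally have "(a + b) ^ p - (a ^ p + b ^ p) = sum ?g {0<..<p}"
    by (simp add: algebra_simps)
  moreover have "of_nat p dvd sum ?g {0<..<p}"
  proof (rule dvd_sum)
    fix k assume "k \<in> {0<..<p}"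
    then have "p dvd (p choose k)"
      using assms by (intro dvd_choose_prime) auto
    then show "of_nat p dvd ?g k"
      by (auto elim!: dvdE simp: mult.assoc)
  qed
  ultimately show ?thesis
    by simp
qed

lemma prime_dvd_int_power_diff:
  assumes "prime p"
  shows "int p dvd c ^ p - c"
proof -
  obtain m :: nat where m: "[c = int m] (mod int p)"
  proof
    show "[c = int (nat (c mod int p))] (mod int p)"
      using assms prime_gt_0_nat by (simp add: cong_def)
  qed
  have "[m ^ p = m] (mod p)"
  proof (cases "p dvd m")
    case True
    then have "p dvd m ^ p"
      using assms by (simp add: prime_dvd_power_iff prime_gt_0_nat)
    with True show ?thesis
      by (simp add: cong_def dvd_imp_mod_0)
  next
    case False
    then have "[m ^ (p - 1) * m = 1 * m] (mod p)"
      by (intro cong_mult fermat_theorem assms cong_refl)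
    then show ?thesis
      using assms prime_gt_0_nat by (simp add: power_eq_if mult.commute)
  qed
  then have "[int m ^ p = int m] (mod int p)"
    by (metis cong_int_iff of_nat_power)
  then have "[c ^ p = c] (mod int p)"
    using m by (meson cong_pow cong_sym cong_trans)
  then show ?thesis
    by (simp add: cong_iff_dvd_diff)
qed

lemma of_nat_dvd_power_diff:
  fixes a b :: "'a::comm_ring_1"
  assumes "p dvd q" and q: "of_nat q dvd a - b"
  shows "of_nat (q * p) dvd a ^ p - b ^ p"
proof -
  let ?S = "\<Sum>i<p. b ^ (p - Suc i) * a ^ i"
  have "of_nat p dvd a - b"
    using assms by (metis dvd_trans dvdE dvd_triv_left of_nat_mult)
  have "?S - of_nat p * b ^ (p - 1) = (\<Sum>i<p. b ^ (p - Suc i) * (a ^ i - b ^ i))"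
    by (simp add: right_diff_distrib sum_subtractf flip: power_add)
  also have "of_nat p dvd \<dots>"
  proof (intro dvd_sum dvd_mult)
    show "of_nat p dvd a ^ i - b ^ i" for i
      using \<open>of_nat p dvd a - b\<close> by (simp add: power_diff_sumr2)
  qed
  finally have "of_nat p dvd ?S"
    by (metis diff_add_cancel dvd_add dvd_triv_left)
  with q show ?thesis
    by (simp add: power_diff_sumr2 mult_dvd_mono)
qed

lemma of_nat_power_dvd_power_diff:
  fixes a b :: "'a::comm_ring_1"
  assumes "of_nat p dvd a - b"
  shows "of_nat (p ^ Suc k) dvd a ^ (p ^ k) - b ^ (p ^ k)"
proof (induction k)
  case (Suc k)
  from of_nat_dvd_power_diff[OF _ this, of p] show ?case
    by (simp add: mult_ac flip: power_mult)
qed (use assms in simp)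


section \<open>Dwork's lemma\<close>

lemma ghost_Suc:
  "ghost p x (Suc n) = ghost p (\<lambda>i. x i ^ p) n + of_nat (p ^ Suc n) * x (Suc n)"
  by (simp add: ghost_def Suc_diff_le flip: power_mult power_Suc)

lemma ghost_cong:
  assumes "\<And>i. i \<le> n \<Longrightarrow> x i = y i"
  shows "ghost p x n = ghost p y n"
  unfolding ghost_def using assms by (intro sum.cong) auto

lemma ghost_diff_eq_below:
  fixes x y :: "nat \<Rightarrow> 'a::comm_ring_1"
  assumes "\<And>i. i < n \<Longrightarrow> x i = y i"
  shows "ghost p x n - ghost p y n = of_nat (p ^ n) * (x n - y n)"
  using assms by (simp add: ghost_def right_diff_distrib flip: lessThan_Suc_atMost)

lemma ghost_dvd_diff:
  fixes x y :: "nat \<Rightarrow> 'a::comm_ring_1"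
  assumes "\<And>i. of_nat p dvd x i - y i"
  shows "of_nat (p ^ Suc n) dvd ghost p x n - ghost p y n"
proof -
  have "ghost p x n - ghost p y n =
      (\<Sum>i\<le>n. of_nat (p ^ i) * (x i ^ (p ^ (n - i)) - y i ^ (p ^ (n - i))))"
    by (simp add: ghost_def sum_subtractf right_diff_distrib)
  also have "of_nat (p ^ Suc n) dvd \<dots>"
  proof (rule dvd_sum)
    fix i assume "i \<in> {..n}"
    then have "p ^ Suc n = p ^ i * p ^ Suc (n - i)"
      by (simp flip: power_add power_Suc)
    moreover have "of_nat (p ^ Suc (n - i)) dvd x i ^ (p ^ (n - i)) - y i ^ (p ^ (n - i))"
      by (intro of_nat_power_dvd_power_diff assms)
    ultimately show "of_nat (p ^ Suc n) dvd
        of_nat (p ^ i) * (x i ^ (p ^ (n - i)) - y i ^ (p ^ (n - i)))"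
      by (simp only: of_nat_mult mult_dvd_mono dvd_refl)
  qed
  finally show ?thesis .
qed

locale frobenius_lift =
  fixes p :: nat and \<phi> :: "'a::comm_ring_1 \<Rightarrow> 'a"
  assumes torsion_free: "\<And>x :: 'a. of_nat p * x = 0 \<Longrightarrow> x = 0"
    and lift_1: "\<phi> 1 = 1"
    and lift_add: "\<And>x y. \<phi> (x + y) = \<phi> x + \<phi> y"
    and lift_mult: "\<And>x y. \<phi> (x * y) = \<phi> x * \<phi> y"
    and lift_frobenius: "\<And>x. of_nat p dvd x ^ p - \<phi> x"
begin

lemma power_torsion_free: "of_nat (p ^ n) * (x :: 'a) = 0 \<Longrightarrow> x = 0"
  by (induction n) (auto simp: mult.assoc intro: torsion_free)

lemma ghost_diff_cancel:
  fixes x y :: "nat \<Rightarrow> 'a"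
  assumes "\<And>m. m < n \<Longrightarrow> ghost p x m = ghost p y m"
    and "ghost p x n - ghost p y n = of_nat (p ^ n) * d"
  shows "x n - y n = d"
  using assms
proof (induction n arbitrary: d rule: less_induct)
  case (less n)
  have "x m = y m" if "m < n" for m
  proof -
    have "x m - y m = 0"
      using less.prems(1) that by (intro less.IH) auto
    then show ?thesis
      by simp
  qed
  from ghost_diff_eq_below[OF this, where p = p] have "of_nat (p ^ n) * (x n - y n - d) = 0"
    using less.prems(2) by (simp add: right_diff_distrib)
  from power_torsion_free[OF this] show ?case
    by simp
qed

lemma ghost_inject:
  fixes x y :: "nat \<Rightarrow> 'a"
  assumes "\<And>n. ghost p x n = ghost p y n"
  shows "x = y"
  using ghost_diff_cancel[of _ x y 0] assms by auto

lemma lift_0: "\<phi> 0 = 0"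
  using lift_add[of 0 0] by simp

lemma lift_of_nat: "\<phi> (of_nat n) = of_nat n"
  by (induction n) (simp_all add: lift_0 lift_1 lift_add)

lemma lift_power: "\<phi> (x ^ n) = \<phi> x ^ n"
  by (induction n) (simp_all add: lift_1 lift_mult)

lemma lift_sum: "\<phi> (\<Sum>i\<in>A. f i) = (\<Sum>i\<in>A. \<phi> (f i))"
  by (induction A rule: infinite_finite_induct) (simp_all add: lift_0 lift_add)

lemma lift_ghost: "\<phi> (ghost p x n) = ghost p (\<lambda>i. \<phi> (x i)) n"
  unfolding ghost_def by (simp only: lift_sum lift_mult lift_of_nat lift_power)

definition dwork_congruent :: "(nat \<Rightarrow> 'a) \<Rightarrow> bool" where
  "dwork_congruent a \<longleftrightarrow> (\<forall>n. of_nat (p ^ Suc n) dvd a (Suc n) - \<phi> (a n))"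

lemma dwork_congruent_ghost: "dwork_congruent (ghost p x)"
  unfolding dwork_congruent_def
proof
  fix n
  have "ghost p x (Suc n) - \<phi> (ghost p x n) =
      (ghost p (\<lambda>i. x i ^ p) n - ghost p (\<lambda>i. \<phi> (x i)) n) + of_nat (p ^ Suc n) * x (Suc n)"
    by (simp only: ghost_Suc lift_ghost) (simp add: algebra_simps)
  moreover have "of_nat (p ^ Suc n) dvd ghost p (\<lambda>i. x i ^ p) n - ghost p (\<lambda>i. \<phi> (x i)) n"
    by (intro ghost_dvd_diff lift_frobenius)
  ultimately show "of_nat (p ^ Suc n) dvd ghost p x (Suc n) - \<phi> (ghost p x n)"
    by (simp only: dvd_add dvd_triv_left)
qed

lemma dwork_congruent_add:
  assumes "dwork_congruent a" "dwork_congruent b"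
  shows "dwork_congruent (\<lambda>n. a n + b n)"
  unfolding dwork_congruent_def
proof
  fix n
  have "a (Suc n) + b (Suc n) - \<phi> (a n + b n) = (a (Suc n) - \<phi> (a n)) + (b (Suc n) - \<phi> (b n))"
    by (simp add: lift_add algebra_simps)
  with assms show "of_nat (p ^ Suc n) dvd a (Suc n) + b (Suc n) - \<phi> (a n + b n)"
    unfolding dwork_congruent_def by (simp only: dvd_add)
qed

lemma dwork_congruent_mult:
  assumes "dwork_congruent a" "dwork_congruent b"
  shows "dwork_congruent (\<lambda>n. a n * b n)"
  unfolding dwork_congruent_def
proof
  fix n
  have "a (Suc n) * b (Suc n) - \<phi> (a n * b n) =
      (a (Suc n) - \<phi> (a n)) * b (Suc n) + \<phi> (a n) * (b (Suc n) - \<phi> (b n))"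
    by (simp add: lift_mult algebra_simps)
  with assms show "of_nat (p ^ Suc n) dvd a (Suc n) * b (Suc n) - \<phi> (a n * b n)"
    unfolding dwork_congruent_def by (simp only: dvd_add dvd_mult dvd_mult2)
qed

lemma ex_ghost_extension:
  fixes x :: "nat \<Rightarrow> 'a"
  assumes a: "dwork_congruent a" and x: "ghost p x n = a n"
  shows "\<exists>r. ghost p (x(Suc n := r)) (Suc n) = a (Suc n)"
proof -
  have "of_nat (p ^ Suc n) dvd a (Suc n) - \<phi> (a n)"
    using a unfolding dwork_congruent_def by blast
  moreover have "of_nat (p ^ Suc n) dvd ghost p (\<lambda>i. x i ^ p) n - \<phi> (a n)"
    unfolding x[symmetric] lift_ghost by (intro ghost_dvd_diff lift_frobenius)
  ultimately have "of_nat (p ^ Suc n) dvd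
      (a (Suc n) - \<phi> (a n)) - (ghost p (\<lambda>i. x i ^ p) n - \<phi> (a n))"
    by (rule dvd_diff)
  then obtain r where "(a (Suc n) - \<phi> (a n)) - (ghost p (\<lambda>i. x i ^ p) n - \<phi> (a n)) =
      of_nat (p ^ Suc n) * r"
    by (rule dvdE)
  then have r: "a (Suc n) = ghost p (\<lambda>i. x i ^ p) n + of_nat (p ^ Suc n) * r"
    by (simp add: algebra_simps)
  have "ghost p (\<lambda>i. (x(Suc n := r)) i ^ p) n = ghost p (\<lambda>i. x i ^ p) n"
    by (intro ghost_cong) auto
  then have "ghost p (x(Suc n := r)) (Suc n) = a (Suc n)"
    by (simp only: ghost_Suc r fun_upd_same)
  then show ?thesis ..
qed

lemma ex_ghost_eq:
  assumes "dwork_congruent a"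
  shows "\<exists>x. \<forall>n. ghost p x n = a n"
proof -
  have "\<exists>x. \<forall>n. ghost p (x(n := x n)) n = a n"
  proof (rule dependent_wellorder_choice)
    fix r and x y :: "nat \<Rightarrow> 'a" and n
    assume "\<And>i. i < n \<Longrightarrow> x i = y i"
    then have "ghost p (x(n := r)) n = ghost p (y(n := r)) n"
      by (intro ghost_cong) auto
    then show "(ghost p (x(n := r)) n = a n) = (ghost p (y(n := r)) n = a n)"
      by simp
  next
    fix n and x :: "nat \<Rightarrow> 'a"
    assume "\<And>m. m < n \<Longrightarrow> ghost p (x(m := x m)) m = a m"
    then show "\<exists>r. ghost p (x(n := r)) n = a n"
      using ex_ghost_extension[OF assms] by (cases n) (simp_all add: ghost_def)
  qed
  then show ?thesis
    by simp
qed

lemma ex1_ghost_eq: "dwork_congruent a \<Longrightarrow> \<exists>!x. \<forall>n. ghost p x n = a n"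
  using ex_ghost_eq ghost_inject by metis

end


section \<open>Integral polynomials and their evaluation\<close>

type_synonym 'v int_poly = "('v \<Rightarrow>\<^sub>0 nat) \<Rightarrow>\<^sub>0 int"

definition mono_eval :: "('v \<Rightarrow> 'a::comm_ring_1) \<Rightarrow> ('v \<Rightarrow>\<^sub>0 nat) \<Rightarrow> 'a" where
  "mono_eval s m = (\<Prod>v\<in>Poly_Mapping.keys m. s v ^ Poly_Mapping.lookup m v)"

definition poly_eval :: "('v \<Rightarrow> 'a::comm_ring_1) \<Rightarrow> 'v int_poly \<Rightarrow> 'a" where
  "poly_eval s P =
     (\<Sum>m\<in>Poly_Mapping.keys P. of_int (Poly_Mapping.lookup P m) * mono_eval s m)"

definition poly_var :: "'v \<Rightarrow> 'v int_poly" where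
  "poly_var v = Poly_Mapping.single (Poly_Mapping.single v 1) 1"

lemma xy_eval_eq_poly_eval: "xy_eval = poly_eval"
  by (intro ext) (simp add: xy_eval_def poly_eval_def mono_eval_def)

lemma xy_var_eq_poly_var: "xy_var = poly_var"
  by (intro ext) (simp add: xy_var_def poly_var_def)

lemma poly_mapping_single_induct [case_names zero add]:
  assumes "P 0"
    and "\<And>f a b. P f \<Longrightarrow> P (Poly_Mapping.single a b + f)"
  shows "P (f :: 'a \<Rightarrow>\<^sub>0 'b::comm_monoid_add)"
proof (induction f rule: Poly_Mapping.update_induct)
  case (update f a b)
  have "Poly_Mapping.update a b f = Poly_Mapping.single a b + f"
    using update.hyps
    by (intro poly_mapping_eqI)
      (auto simp: lookup_add lookup_single lookup_update in_keys_iff when_def)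
  then show ?case
    using assms(2)[OF update.IH] by simp
qed (rule assms(1))

lemma mono_eval_superset:
  assumes "finite A" "Poly_Mapping.keys m \<subseteq> A"
  shows "mono_eval s m = (\<Prod>v\<in>A. s v ^ Poly_Mapping.lookup m v)"
  unfolding mono_eval_def
  by (rule prod.mono_neutral_left) (use assms in \<open>auto simp: in_keys_iff\<close>)

lemma mono_eval_0 [simp]: "mono_eval s 0 = 1"
  by (simp add: mono_eval_def)

lemma mono_eval_add: "mono_eval s (m + m') = mono_eval s m * mono_eval s m'"
proof -
  let ?A = "Poly_Mapping.keys m \<union> Poly_Mapping.keys m'"
  have "Poly_Mapping.keys (m + m') \<subseteq> ?A"
    by (rule Poly_Mapping.keys_add)
  then show ?thesis
    by (simp add: mono_eval_superset[of ?A] lookup_add power_add prod.distrib)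
qed

lemma mono_eval_single: "mono_eval s (Poly_Mapping.single v n) = s v ^ n"
  by (cases "n = 0") (simp_all add: mono_eval_def)

lemma mono_eval_power: "mono_eval (\<lambda>v. s v ^ n) m = mono_eval s m ^ n"
  by (simp add: mono_eval_def prod_power_distrib mult.commute flip: power_mult)

lemma poly_var_power:
  "poly_var v ^ n = Poly_Mapping.single (Poly_Mapping.single v n) 1"
  by (induction n) (simp_all add: poly_var_def mult_single flip: single_add)

lemma mono_eval_poly_var: "mono_eval poly_var m = Poly_Mapping.single m 1"
proof (induction m rule: poly_mapping_single_induct)
  case (add m v n)
  then show ?case
    by (simp add: mono_eval_add mono_eval_single poly_var_power mult_single)
qed simp

lemma poly_eval_0 [simp]: "poly_eval s 0 = 0"
  by (simp add: poly_eval_def)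

lemma poly_eval_add: "poly_eval s (P + Q) = poly_eval s P + poly_eval s Q"
  unfolding poly_eval_def
  by (rule setsum_keys_plus_distrib) (simp_all add: algebra_simps)

lemma poly_eval_single:
  "poly_eval s (Poly_Mapping.single m c) = of_int c * mono_eval s m"
  by (cases "c = 0") (simp_all add: poly_eval_def)

lemma poly_eval_mult: "poly_eval s (P * Q) = poly_eval s P * poly_eval s Q"
proof (induction P rule: poly_mapping_single_induct)
  case (add P m c)
  have "poly_eval s (Poly_Mapping.single m c * Q) =
      poly_eval s (Poly_Mapping.single m c) * poly_eval s Q"
  proof (induction Q rule: poly_mapping_single_induct)
    case (add Q m' c')
    then show ?case
      by (simp add: poly_eval_add poly_eval_single mult_single mono_eval_add algebra_simps)
  qed simp
  with add show ?case
    by (simp add: poly_eval_add algebra_simps)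
qed simp

lemma poly_eval_of_int [simp]: "poly_eval s (of_int n) = of_int n"
  using poly_eval_single[of s 0 n] by (simp flip: single_of_int)

lemma poly_eval_of_nat [simp]: "poly_eval s (of_nat n) = of_nat n"
  using poly_eval_of_int[of s "int n"] by simp

lemma poly_eval_1 [simp]: "poly_eval s 1 = 1"
  using poly_eval_of_nat[of s 1] by simp

lemma poly_eval_diff: "poly_eval s (P - Q) = poly_eval s P - poly_eval s Q"
  using poly_eval_add[of s "P - Q" Q] by (simp add: algebra_simps)

lemma poly_eval_power: "poly_eval s (P ^ n) = poly_eval s P ^ n"
  by (induction n) (simp_all add: poly_eval_mult)

lemma poly_eval_sum: "poly_eval s (\<Sum>i\<in>A. f i) = (\<Sum>i\<in>A. poly_eval s (f i))"
  by (induction A rule: infinite_finite_induct) (simp_all add: poly_eval_add)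

lemma poly_eval_prod: "poly_eval s (\<Prod>i\<in>A. f i) = (\<Prod>i\<in>A. poly_eval s (f i))"
  by (induction A rule: infinite_finite_induct) (simp_all add: poly_eval_mult)

lemma poly_eval_var [simp]: "poly_eval s (poly_var v) = s v"
  by (simp add: poly_var_def poly_eval_single mono_eval_single)

lemma poly_eval_poly_eval:
  "poly_eval t (poly_eval s P) = poly_eval (\<lambda>v. poly_eval t (s v)) P"
  by (simp add: poly_eval_def[of s] poly_eval_def[of "\<lambda>v. poly_eval t (s v)"] mono_eval_def
      poly_eval_sum poly_eval_mult poly_eval_prod poly_eval_power)

lemma poly_eval_ghost: "poly_eval s (ghost p X n) = ghost p (\<lambda>i. poly_eval s (X i)) n"
  by (simp add: ghost_def poly_eval_sum poly_eval_mult poly_eval_power)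

lemma lookup_of_nat_times:
  "Poly_Mapping.lookup (of_nat c * (P :: 'v int_poly)) m = int c * Poly_Mapping.lookup P m"
  by (induction c) (simp_all add: algebra_simps lookup_add)

lemma poly_torsion_free:
  fixes P :: "'v int_poly"
  assumes "of_nat c * P = 0" "c \<noteq> 0"
  shows "P = 0"
proof (rule poly_mapping_eqI)
  fix m
  show "Poly_Mapping.lookup P m = Poly_Mapping.lookup 0 m"
    using lookup_of_nat_times[of c P m] assms by simp
qed

abbreviation poly_frobenius :: "nat \<Rightarrow> 'v int_poly \<Rightarrow> 'v int_poly" where
  "poly_frobenius p \<equiv> poly_eval (\<lambda>v. poly_var v ^ p)"

lemma prime_dvd_power_diff_poly_frobenius:
  fixes P :: "'v int_poly"
  assumes "prime p"
  shows "of_nat p dvd P ^ p - poly_frobenius p P"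
proof (induction P rule: poly_mapping_single_induct)
  case zero
  show ?case
    using assms prime_gt_0_nat by (simp add: power_0_left)
next
  case (add P m c)
  let ?F = "poly_frobenius p :: _ \<Rightarrow> 'v int_poly"
  let ?M = "Poly_Mapping.single m c"
  have M: "?M = of_int c * mono_eval poly_var m"
    by (simp add: mono_eval_poly_var mult_single flip: single_of_int)
  have "of_nat p dvd (of_int (c ^ p - c) :: 'v int_poly)"
    using prime_dvd_int_power_diff[OF assms, of c] by (metis of_int_mult of_int_of_nat_eq dvd_def)
  moreover have "?M ^ p - ?F ?M = of_int (c ^ p - c) * mono_eval poly_var m ^ p"
    by (simp add: poly_eval_single mono_eval_power) (simp add: M power_mult_distrib algebra_simps)
  ultimately have "of_nat p dvd ?M ^ p - ?F ?M"
    by simp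
  from dvd_add[OF dvd_add[OF this add.IH] prime_dvd_add_power_diff[OF assms, of ?M P]]
  show ?case
    by (simp add: poly_eval_add algebra_simps)
qed

lemma frobenius_lift_poly_frobenius: "prime p \<Longrightarrow> frobenius_lift p (poly_frobenius p)"
  by unfold_locales
    (auto simp: poly_eval_add poly_eval_mult prime_gt_0_nat dest!: poly_torsion_free
      intro: prime_dvd_power_diff_poly_frobenius)


section \<open>The multiplicative monoid of Witt vectors\<close>

text \<open>
  Every ring \<open>A\<close> is the image of the torsion-free ring \<open>\<int>[A]\<close>, where Witt vectors are determined
  by their ghost components. So it suffices to check identities on \<open>\<int>[A]\<close>. The lift maps \<open>0\<close> to \<open>0\<close>
  and not to a variable, so that it preserves supports.
\<close>

definition witt_lift :: "(nat \<Rightarrow> 'a::comm_ring_1) \<Rightarrow> nat \<Rightarrow> 'a int_poly" where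
  "witt_lift x = (\<lambda>i. if x i = 0 then 0 else poly_var (x i))"

definition witt_proj :: "(nat \<Rightarrow> 'a::comm_ring_1 int_poly) \<Rightarrow> nat \<Rightarrow> 'a" where
  "witt_proj x = (\<lambda>i. poly_eval (\<lambda>a. a) (x i))"

lemma poly_eval_witt_lift [simp]: "poly_eval (\<lambda>a. a) (witt_lift x i) = x i"
  by (simp add: witt_lift_def)

lemma witt_proj_lift [simp]: "witt_proj (witt_lift x) = x"
  by (simp add: witt_proj_def)

lemma witt_proj_teichmueller [simp]:
  "witt_proj (teichmueller a) = teichmueller (poly_eval (\<lambda>a. a) a)"
  by (auto simp: witt_proj_def teichmueller_def)

lemma ghost_teichmueller: "p \<noteq> 0 \<Longrightarrow> ghost p (teichmueller a) n = a ^ (p ^ n)"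
  by (simp add: ghost_def sum.atMost_shift teichmueller_def power_0_left)

lemma ghost_char_p: "of_nat p = (0 :: 'a::comm_ring_1) \<Longrightarrow> ghost p x n = (x 0 :: 'a) ^ (p ^ n)"
  by (simp add: ghost_def sum.atMost_shift)

lemma carrier_witt_ring [simp]: "carrier (witt_ring p) = UNIV"
  by (simp add: witt_ring_def)

lemma witt_one_eq_teichmueller: "\<one>\<^bsub>witt_ring p\<^esub> = teichmueller 1"
  by (simp add: witt_ring_def teichmueller_def)

lemma witt_one_nth: "\<one>\<^bsub>witt_ring p\<^esub> n = (if n = 0 then 1 else 0)"
  by (simp add: witt_ring_def)

lemma witt_mult_nth: "(x \<otimes>\<^bsub>witt_ring p\<^esub> y) n = poly_eval (case_sum x y) (witt_mult_poly p n)"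
  by (simp add: witt_ring_def xy_eval_eq_poly_eval)

lemma witt_add_nth: "(x \<oplus>\<^bsub>witt_ring p\<^esub> y) n = poly_eval (case_sum x y) (witt_add_poly p n)"
  by (simp add: witt_ring_def xy_eval_eq_poly_eval)

lemma poly_eval_witt_mult:
  "poly_eval s ((x \<otimes>\<^bsub>witt_ring p\<^esub> y) n) =
    ((\<lambda>i. poly_eval s (x i)) \<otimes>\<^bsub>witt_ring p\<^esub> (\<lambda>i. poly_eval s (y i))) n"
  by (simp add: witt_mult_nth poly_eval_poly_eval sum.case_distrib[of "poly_eval s"])

lemma poly_eval_witt_add:
  "poly_eval s ((x \<oplus>\<^bsub>witt_ring p\<^esub> y) n) =
    ((\<lambda>i. poly_eval s (x i)) \<oplus>\<^bsub>witt_ring p\<^esub> (\<lambda>i. poly_eval s (y i))) n"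
  by (simp add: witt_add_nth poly_eval_poly_eval sum.case_distrib[of "poly_eval s"])

lemma witt_proj_mult [simp]:
  "witt_proj (x \<otimes>\<^bsub>witt_ring p\<^esub> y) = witt_proj x \<otimes>\<^bsub>witt_ring p\<^esub> witt_proj y"
  by (simp add: witt_proj_def poly_eval_witt_mult)

lemma witt_proj_add [simp]:
  "witt_proj (x \<oplus>\<^bsub>witt_ring p\<^esub> y) = witt_proj x \<oplus>\<^bsub>witt_ring p\<^esub> witt_proj y"
  by (simp add: witt_proj_def poly_eval_witt_add)

lemma (in comm_monoid) finprod_subset_diff:
  assumes "finite F" "E \<subseteq> F" "f \<in> F \<rightarrow> carrier G"
  shows "finprod G f F = finprod G f E \<otimes> finprod G f (F - E)"
proof -
  have "finprod G f (E \<union> (F - E)) = finprod G f E \<otimes> finprod G f (F - E)"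
    using assms finite_subset by (intro finprod_Un_disjoint) auto
  moreover have "E \<union> (F - E) = F"
    using assms by auto
  ultimately show ?thesis
    by simp
qed

lemma (in comm_monoid) nat_pow_eq_finprod:
  "x \<in> carrier G \<Longrightarrow> x [^] (n :: nat) = finprod G (\<lambda>_. x) {..<n}"
  by (simp add: finprod_const)

locale witt_vectors =
  fixes p :: nat
  assumes prime_p: "prime p"
begin

abbreviation W :: "(nat \<Rightarrow> 'a::comm_ring_1) ring" where
  "W \<equiv> witt_ring p"

lemma p_nonzero: "p \<noteq> 0"
  using prime_p by auto

interpretation poly: frobenius_lift p "poly_frobenius p"
  by (rule frobenius_lift_poly_frobenius) (rule prime_p)

lemma ghost_witt_add_poly:
  "ghost p (witt_add_poly p) n =
    ghost p (\<lambda>i. poly_var (Inl i)) n + ghost p (\<lambda>i. poly_var (Inr i)) n"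
  unfolding witt_add_poly_def xy_var_eq_poly_var
  by (rule spec[OF theI'[OF poly.ex1_ghost_eq]])
    (intro poly.dwork_congruent_add poly.dwork_congruent_ghost)

lemma ghost_witt_mult_poly:
  "ghost p (witt_mult_poly p) n =
    ghost p (\<lambda>i. poly_var (Inl i)) n * ghost p (\<lambda>i. poly_var (Inr i)) n"
  unfolding witt_mult_poly_def xy_var_eq_poly_var
  by (rule spec[OF theI'[OF poly.ex1_ghost_eq]])
    (intro poly.dwork_congruent_mult poly.dwork_congruent_ghost)

lemma ghost_witt_mult: "ghost p (x \<otimes>\<^bsub>W\<^esub> y) n = ghost p x n * ghost p y n"
  using arg_cong[OF ghost_witt_mult_poly[of n], of "poly_eval (case_sum x y)"]
  by (simp add: poly_eval_ghost poly_eval_mult flip: witt_mult_nth)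

lemma ghost_witt_add: "ghost p (x \<oplus>\<^bsub>W\<^esub> y) n = ghost p x n + ghost p y n"
  using arg_cong[OF ghost_witt_add_poly[of n], of "poly_eval (case_sum x y)"]
  by (simp add: poly_eval_ghost poly_eval_add flip: witt_add_nth)

lemma witt_proj_eqI:
  assumes "\<And>n. ghost p X n = ghost p Y n"
  shows "witt_proj X = witt_proj Y"
  using poly.ghost_inject[OF assms] by simp

lemma witt_mult_assoc: "(x \<otimes>\<^bsub>W\<^esub> y) \<otimes>\<^bsub>W\<^esub> z = x \<otimes>\<^bsub>W\<^esub> (y \<otimes>\<^bsub>W\<^esub> z)"
  using witt_proj_eqI[of "(witt_lift x \<otimes>\<^bsub>W\<^esub> witt_lift y) \<otimes>\<^bsub>W\<^esub> witt_lift z"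
      "witt_lift x \<otimes>\<^bsub>W\<^esub> (witt_lift y \<otimes>\<^bsub>W\<^esub> witt_lift z)"]
  by (simp add: ghost_witt_mult mult.assoc)

lemma witt_mult_commute: "x \<otimes>\<^bsub>W\<^esub> y = y \<otimes>\<^bsub>W\<^esub> x"
  using witt_proj_eqI[of "witt_lift x \<otimes>\<^bsub>W\<^esub> witt_lift y" "witt_lift y \<otimes>\<^bsub>W\<^esub> witt_lift x"]
  by (simp add: ghost_witt_mult mult.commute)

lemma witt_one_mult: "\<one>\<^bsub>W\<^esub> \<otimes>\<^bsub>W\<^esub> x = x"
  using witt_proj_eqI[of "teichmueller 1 \<otimes>\<^bsub>W\<^esub> witt_lift x" "witt_lift x"]
  by (simp add: ghost_witt_mult ghost_teichmueller p_nonzero witt_one_eq_teichmueller)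

sublocale comm_monoid "W :: (nat \<Rightarrow> 'a::comm_ring_1) ring"
  by (rule comm_monoidI) (auto simp: witt_one_mult witt_mult_assoc intro: witt_mult_commute)

lemma teichmueller_mult: "teichmueller a \<otimes>\<^bsub>W\<^esub> teichmueller b = teichmueller (a * b)"
  using witt_proj_eqI[of "teichmueller (poly_var a) \<otimes>\<^bsub>W\<^esub> teichmueller (poly_var b)"
      "teichmueller (poly_var a * poly_var b)"]
  by (simp add: ghost_witt_mult ghost_teichmueller p_nonzero power_mult_distrib poly_eval_mult)

lemma teichmueller_nat_pow: "teichmueller a [^]\<^bsub>W\<^esub> (n :: nat) = teichmueller (a ^ n)"
  by (induction n) (simp_all add: witt_one_eq_teichmueller teichmueller_mult mult.commute)

lemma finprod_teichmueller:
  "finprod W (\<lambda>i. teichmueller (f i)) F = teichmueller (\<Prod>i\<in>F. f i)"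
  by (induction F rule: infinite_finite_induct)
    (simp_all add: witt_one_eq_teichmueller teichmueller_mult)

lemma witt_add_disjoint:
  assumes "\<And>i. x i = 0 \<or> y i = 0"
  shows "x \<oplus>\<^bsub>W\<^esub> y = (\<lambda>i. x i + y i)"
proof -
  have "witt_proj (witt_lift x \<oplus>\<^bsub>W\<^esub> witt_lift y) = witt_proj (\<lambda>i. witt_lift x i + witt_lift y i)"
  proof (rule witt_proj_eqI)
    fix n
    have "(witt_lift x i + witt_lift y i) ^ (p ^ (n - i)) =
        witt_lift x i ^ (p ^ (n - i)) + witt_lift y i ^ (p ^ (n - i))" for i
      using assms[of i] by (auto simp: witt_lift_def p_nonzero power_0_left)
    then show "ghost p (witt_lift x \<oplus>\<^bsub>W\<^esub> witt_lift y) n =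
        ghost p (\<lambda>i. witt_lift x i + witt_lift y i) n"
      unfolding ghost_witt_add by (simp add: ghost_def algebra_simps sum.distrib)
  qed
  also have "\<dots> = (\<lambda>i. witt_proj (witt_lift x) i + witt_proj (witt_lift y) i)"
    by (simp add: witt_proj_def poly_eval_add)
  finally show ?thesis
    by simp
qed

lemma witt_mult_diff_nth:
  assumes "\<And>m. m < n \<Longrightarrow> y m = y' m"
  shows "(x \<otimes>\<^bsub>W\<^esub> y) n - (x \<otimes>\<^bsub>W\<^esub> y') n = ghost p x n * (y n - y' n)"
proof -
  let ?X = "witt_lift x" and ?Y = "witt_lift y" and ?Y' = "witt_lift y'"
  have eq: "?Y m = ?Y' m" if "m < n" for m
    using assms[OF that] by (simp add: witt_lift_def)
  have "(?X \<otimes>\<^bsub>W\<^esub> ?Y) n - (?X \<otimes>\<^bsub>W\<^esub> ?Y') n = ghost p ?X n * (?Y n - ?Y' n)"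
  proof (rule poly.ghost_diff_cancel)
    fix m assume "m < n"
    then have "ghost p ?Y m = ghost p ?Y' m"
      by (intro ghost_cong eq) simp
    then show "ghost p (?X \<otimes>\<^bsub>W\<^esub> ?Y) m = ghost p (?X \<otimes>\<^bsub>W\<^esub> ?Y') m"
      by (simp add: ghost_witt_mult)
  next
    have "ghost p (?X \<otimes>\<^bsub>W\<^esub> ?Y) n - ghost p (?X \<otimes>\<^bsub>W\<^esub> ?Y') n =
        ghost p ?X n * (ghost p ?Y n - ghost p ?Y' n)"
      by (simp add: ghost_witt_mult right_diff_distrib)
    then show "ghost p (?X \<otimes>\<^bsub>W\<^esub> ?Y) n - ghost p (?X \<otimes>\<^bsub>W\<^esub> ?Y') n =
        of_nat (p ^ n) * (ghost p ?X n * (?Y n - ?Y' n))"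
      by (simp only: ghost_diff_eq_below[OF eq] mult.left_commute)
  qed
  from arg_cong[OF this, of "poly_eval (\<lambda>a. a)"] show ?thesis
    by (simp add: poly_eval_diff poly_eval_mult poly_eval_ghost poly_eval_witt_mult)
qed

lemma witt_mult_nth_cong:
  assumes "\<And>i. i \<le> n \<Longrightarrow> y i = y' i"
  shows "(x \<otimes>\<^bsub>W\<^esub> y) n = (x \<otimes>\<^bsub>W\<^esub> y') n"
  using witt_mult_diff_nth[of n y y' x] assms by simp

lemma witt_mult_nth_0: "(x \<otimes>\<^bsub>W\<^esub> y) 0 = x 0 * y 0"
  using ghost_witt_mult[of x y 0] by (simp add: ghost_def)

lemma ex_witt_mult_eq:
  fixes x z :: "nat \<Rightarrow> 'a::comm_ring_1"
  assumes char: "of_nat p = (0 :: 'a)" and x: "x 0 dvd 1"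
  shows "\<exists>y. x \<otimes>\<^bsub>W\<^esub> y = z"
proof -
  have "\<exists>y. \<forall>n. (x \<otimes>\<^bsub>W\<^esub> y(n := y n)) n = z n"
  proof (rule dependent_wellorder_choice)
    fix r and y y' :: "nat \<Rightarrow> 'a" and n
    assume "\<And>i. i < n \<Longrightarrow> y i = y' i"
    then have "(x \<otimes>\<^bsub>W\<^esub> y(n := r)) n = (x \<otimes>\<^bsub>W\<^esub> y'(n := r)) n"
      by (intro witt_mult_nth_cong) auto
    then show "((x \<otimes>\<^bsub>W\<^esub> y(n := r)) n = z n) = ((x \<otimes>\<^bsub>W\<^esub> y'(n := r)) n = z n)"
      by simp
  next
    fix y and n
    have "x 0 ^ (p ^ n) dvd 1"
      using dvd_power_same[OF x, of "p ^ n"] by simp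
    then obtain r where "z n - (x \<otimes>\<^bsub>W\<^esub> y) n = x 0 ^ (p ^ n) * r"
      by (meson dvdE dvd_trans one_dvd)
    then have "(x \<otimes>\<^bsub>W\<^esub> y(n := y n + r)) n = z n"
      using witt_mult_diff_nth[of n "y(n := y n + r)" y x]
      by (simp add: ghost_char_p[OF char] diff_eq_eq)
    then show "\<exists>r. (x \<otimes>\<^bsub>W\<^esub> y(n := r)) n = z n" ..
  qed
  then show ?thesis
    by (auto simp: fun_eq_iff)
qed

lemma Units_witt_ring_iff:
  fixes x :: "nat \<Rightarrow> 'a::comm_ring_1"
  assumes "of_nat p = (0 :: 'a)"
  shows "x \<in> Units W \<longleftrightarrow> x 0 dvd 1"
proof
  assume "x \<in> Units W"
  then obtain y where "x \<otimes>\<^bsub>W\<^esub> y = \<one>\<^bsub>W\<^esub>"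
    by (auto simp: Units_def)
  from fun_cong[OF this, of 0] show "x 0 dvd 1"
    by (metis dvd_triv_left witt_mult_nth_0 witt_one_nth)
next
  assume "x 0 dvd 1"
  then obtain y where "x \<otimes>\<^bsub>W\<^esub> y = \<one>\<^bsub>W\<^esub>"
    using ex_witt_mult_eq[OF assms] by blast
  then show "x \<in> Units W"
    using m_comm[of x y] by (auto simp: Units_def)
qed


section \<open>The filtration of the unit group by \<open>1 + V\<^sup>n W\<close>\<close>

definition one_plus_V :: "nat \<Rightarrow> (nat \<Rightarrow> 'a::comm_ring_1) set" where
  "one_plus_V n = {x. \<forall>i<n. x i = \<one>\<^bsub>W\<^esub> i}"

lemma one_in_one_plus_V [simp]: "\<one>\<^bsub>W\<^esub> \<in> one_plus_V n"
  by (simp add: one_plus_V_def)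

lemma one_plus_V_nth_0: "x \<in> one_plus_V n \<Longrightarrow> 0 < n \<Longrightarrow> x 0 = 1"
  by (simp add: one_plus_V_def witt_one_nth)

lemma one_plus_V_antimono: "m \<le> n \<Longrightarrow> one_plus_V n \<subseteq> one_plus_V m"
  by (auto simp: one_plus_V_def)

lemma witt_mult_nth_eq_left:
  assumes "y \<in> one_plus_V (Suc n)"
  shows "(x \<otimes>\<^bsub>W\<^esub> y) n = x n"
proof -
  have "(x \<otimes>\<^bsub>W\<^esub> y) n = (x \<otimes>\<^bsub>W\<^esub> \<one>\<^bsub>W\<^esub>) n"
    using assms by (intro witt_mult_nth_cong) (simp add: one_plus_V_def)
  then show ?thesis
    by simp
qed

lemma one_plus_V_mult_iff:
  assumes "x \<in> one_plus_V n"
  shows "x \<otimes>\<^bsub>W\<^esub> y \<in> one_plus_V n \<longleftrightarrow> y \<in> one_plus_V n"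
proof -
  have "(x \<otimes>\<^bsub>W\<^esub> y) i = y i" if "i < n" for i
    using witt_mult_nth_eq_left[of x i y] one_plus_V_antimono[of "Suc i" n] assms that
    by (auto simp: m_comm[of x])
  then show ?thesis
    by (simp add: one_plus_V_def)
qed

lemma one_plus_V_finprod:
  "(\<And>i. i \<in> F \<Longrightarrow> f i \<in> one_plus_V n) \<Longrightarrow> finprod W f F \<in> one_plus_V n"
  by (induction F rule: infinite_finite_induct)
    (auto simp: one_plus_V_mult_iff)

lemma finprod_nth_eq_subset:
  assumes "finite F" "E \<subseteq> F" and "\<And>i. i \<in> F - E \<Longrightarrow> f i \<in> one_plus_V (Suc n)"
  shows "finprod W f F n = finprod W f E n"
proof -
  have "finprod W f (F - E) \<in> one_plus_V (Suc n)"
    using assms(3) by (rule one_plus_V_finprod)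
  then show ?thesis
    using assms(1,2) by (simp add: finprod_subset_diff witt_mult_nth_eq_left)
qed

lemma one_plus_V_subset_Units:
  assumes "of_nat p = (0 :: 'a::comm_ring_1)" and "0 < n"
  shows "(one_plus_V n :: (nat \<Rightarrow> 'a) set) \<subseteq> Units W"
  using assms by (auto simp: Units_witt_ring_iff one_plus_V_nth_0)

lemma one_plus_V_mult_nth:
  fixes x y :: "nat \<Rightarrow> 'a::comm_ring_1"
  assumes "of_nat p = (0 :: 'a)" and "0 < n" and "x \<in> one_plus_V n" "y \<in> one_plus_V n"
  shows "(x \<otimes>\<^bsub>W\<^esub> y) n = x n + y n"
proof -
  have "(x \<otimes>\<^bsub>W\<^esub> y) n - (x \<otimes>\<^bsub>W\<^esub> \<one>\<^bsub>W\<^esub>) n = ghost p x n * (y n - \<one>\<^bsub>W\<^esub> n)"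
    using assms by (intro witt_mult_diff_nth) (simp add: one_plus_V_def)
  then show ?thesis
    using assms by (simp add: ghost_char_p one_plus_V_nth_0 witt_one_nth diff_eq_eq add.commute)
qed

lemma one_plus_V_finprod_nth:
  fixes f :: "'i \<Rightarrow> nat \<Rightarrow> 'a::comm_ring_1"
  assumes char: "of_nat p = (0 :: 'a)" and n: "0 < n"
    and "\<And>i. i \<in> F \<Longrightarrow> f i \<in> one_plus_V n"
  shows "finprod W f F n = (\<Sum>i\<in>F. f i n)"
  using assms(3)
  by (induction F rule: infinite_finite_induct)
    (use n in \<open>auto simp: one_plus_V_mult_nth[OF char n] one_plus_V_finprod witt_one_nth\<close>)

lemma one_plus_V_nat_pow: "x \<in> one_plus_V n \<Longrightarrow> x [^]\<^bsub>W\<^esub> (k :: nat) \<in> one_plus_V n"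
  by (simp add: nat_pow_eq_finprod one_plus_V_finprod)

lemma one_plus_V_nat_pow_nth:
  fixes x :: "nat \<Rightarrow> 'a::comm_ring_1" and k :: nat
  assumes "of_nat p = (0 :: 'a)" and "0 < n" and "x \<in> one_plus_V n"
  shows "(x [^]\<^bsub>W\<^esub> k) n = of_nat k * x n"
  using assms by (simp add: nat_pow_eq_finprod one_plus_V_finprod_nth)

lemma one_plus_V_Suc_quotient:
  fixes q r :: "nat \<Rightarrow> 'a::comm_ring_1"
  assumes char: "of_nat p = (0 :: 'a)" and n: "0 < n"
    and q: "q \<in> one_plus_V n" and r: "r \<in> one_plus_V n" and eq: "q n = r n"
  shows "\<exists>s \<in> one_plus_V (Suc n). r = q \<otimes>\<^bsub>W\<^esub> s"
proof -
  obtain s where s: "q \<otimes>\<^bsub>W\<^esub> s = r"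
    using ex_witt_mult_eq[OF char, of q r] one_plus_V_nth_0[OF q n] by auto
  have "s \<in> one_plus_V n"
    using one_plus_V_mult_iff[OF q, of s] r s by simp
  moreover from this have "s n = 0"
    using one_plus_V_mult_nth[OF char n q, of s] s eq by simp
  ultimately have "s \<in> one_plus_V (Suc n)"
    using n by (auto simp: one_plus_V_def witt_one_nth less_Suc_eq)
  with s show ?thesis
    by auto
qed

end


section \<open>The \<open>T\<close>-adic topology\<close>

definition fls_X_ideal :: "int \<Rightarrow> 'a::zero fls set" where
  "fls_X_ideal N = {f. \<forall>k<N. f $$ k = 0}"

lemma fls_X_ideal_iff: "f \<in> fls_X_ideal N \<longleftrightarrow> f = 0 \<or> N \<le> fls_subdegree f"
  by (auto simp: fls_X_ideal_def intro: fls_subdegree_geI)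

lemma fls_X_ideal_antimono: "M \<le> N \<Longrightarrow> fls_X_ideal N \<subseteq> fls_X_ideal M"
  by (auto simp: fls_X_ideal_def)

lemma fls_X_ideal_add: "f \<in> fls_X_ideal N \<Longrightarrow> g \<in> fls_X_ideal N \<Longrightarrow> f + g \<in> fls_X_ideal N"
  for f g :: "'a::monoid_add fls"
  by (simp add: fls_X_ideal_def)

lemma fls_X_ideal_diff_nth: "f - g \<in> fls_X_ideal N \<Longrightarrow> k < N \<Longrightarrow> f $$ k = g $$ k"
  for f g :: "'a::group_add fls"
  by (simp add: fls_X_ideal_def)

lemma fls_X_ideal_mult:
  fixes f g :: "'a::comm_ring_1 fls"
  assumes "f \<in> fls_X_ideal M" "g \<in> fls_X_ideal N"
  shows "f * g \<in> fls_X_ideal (M + N)"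
proof (cases "f * g = 0")
  case False
  then have "f \<noteq> 0" "g \<noteq> 0"
    by auto
  with assms fls_mult_subdegree_ge[OF False] show ?thesis
    by (auto simp: fls_X_ideal_iff)
qed (simp add: fls_X_ideal_iff)

lemma dist_fls_le_iff:
  fixes f g :: "'a::group_add fls"
  shows "dist f g \<le> inverse (2 ^ N) \<longleftrightarrow> f - g \<in> fls_X_ideal (int N)"
proof (cases "f = g \<or> 0 \<le> fls_subdegree (f - g)")
  case True
  then show ?thesis
    by (auto simp: dist_fls_def fls_X_ideal_iff nat_le_iff)
next
  case False
  have "inverse (2 ^ N) \<le> (1 :: real)"
    by (simp add: inverse_le_1_iff)
  also have "\<dots> < 2 ^ nat (- fls_subdegree (f - g))"
    using False by (intro one_less_power) auto
  also have "\<dots> = dist f g"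
    using False by (simp add: dist_fls_def)
  finally show ?thesis
    using False by (auto simp: fls_X_ideal_iff)
qed

lemma tendsto_fls_iff:
  fixes f :: "'b \<Rightarrow> 'a::group_add fls"
  shows "(f \<longlongrightarrow> l) F \<longleftrightarrow> (\<forall>N. eventually (\<lambda>x. f x - l \<in> fls_X_ideal N) F)"
proof (intro iffI allI)
  fix N
  assume "(f \<longlongrightarrow> l) F"
  then have "eventually (\<lambda>x. dist (f x) l < inverse (2 ^ nat N)) F"
    by (rule tendstoD) simp
  then show "eventually (\<lambda>x. f x - l \<in> fls_X_ideal N) F"
  proof eventually_elim
    case (elim x)
    then have "f x - l \<in> fls_X_ideal (int (nat N))"
      by (intro dist_fls_le_iff[THEN iffD1] less_imp_le)
    then show ?case
      by (rule subsetD[OF fls_X_ideal_antimono, rotated]) simp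
  qed
next
  assume f: "\<forall>N. eventually (\<lambda>x. f x - l \<in> fls_X_ideal N) F"
  show "(f \<longlongrightarrow> l) F"
  proof (rule tendstoI)
    fix e :: real assume "0 < e"
    then obtain N where "(1 / 2) ^ N < e"
      using real_arch_pow_inv[of e "1/2"] by auto
    then have N: "inverse (2 ^ N) < e"
      by (simp add: power_one_over inverse_eq_divide)
    from f have "eventually (\<lambda>x. f x - l \<in> fls_X_ideal (int N)) F" ..
    then show "eventually (\<lambda>x. dist (f x) l < e) F"
      by eventually_elim (use N in \<open>auto simp flip: dist_fls_le_iff\<close>)
  qed
qed

lemma tendsto_fls_add:
  fixes f g :: "'b \<Rightarrow> 'a::ab_group_add fls"
  assumes "(f \<longlongrightarrow> a) F" "(g \<longlongrightarrow> b) F"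
  shows "((\<lambda>x. f x + g x) \<longlongrightarrow> a + b) F"
  unfolding tendsto_fls_iff
proof
  fix N
  have "eventually (\<lambda>x. f x - a \<in> fls_X_ideal N) F" "eventually (\<lambda>x. g x - b \<in> fls_X_ideal N) F"
    using assms by (simp_all add: tendsto_fls_iff)
  then show "eventually (\<lambda>x. f x + g x - (a + b) \<in> fls_X_ideal N) F"
    by eventually_elim (simp add: fls_X_ideal_def)
qed

lemma tendsto_fls_mult:
  fixes f g :: "'b \<Rightarrow> 'a::comm_ring_1 fls"
  assumes "(f \<longlongrightarrow> a) F" "(g \<longlongrightarrow> b) F"
  shows "((\<lambda>x. f x * g x) \<longlongrightarrow> a * b) F"
  unfolding tendsto_fls_iff
proof
  fix N
  define M where "M = \<bar>N\<bar> + \<bar>fls_subdegree a\<bar> + \<bar>fls_subdegree b\<bar>"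
  have "eventually (\<lambda>x. f x - a \<in> fls_X_ideal M) F" "eventually (\<lambda>x. g x - b \<in> fls_X_ideal M) F"
    using assms by (simp_all add: tendsto_fls_iff)
  then show "eventually (\<lambda>x. f x * g x - a * b \<in> fls_X_ideal N) F"
  proof eventually_elim
    case (elim x)
    have mult: "u * v \<in> fls_X_ideal N"
      if "u \<in> fls_X_ideal i" "v \<in> fls_X_ideal j" "N \<le> i + j" for u v :: "'a fls" and i j
      using fls_X_ideal_mult[OF that(1,2)] fls_X_ideal_antimono[OF that(3)] by auto
    have "f x * g x - a * b = (f x - a) * (g x - b) + a * (g x - b) + (f x - a) * b"
      by (simp add: algebra_simps)
    also have "\<dots> \<in> fls_X_ideal N"
    proof (intro fls_X_ideal_add)
      show "(f x - a) * (g x - b) \<in> fls_X_ideal N"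
        by (rule mult[OF elim]) (simp add: M_def)
      show "a * (g x - b) \<in> fls_X_ideal N"
        by (rule mult[OF _ elim(2), of _ "fls_subdegree a"]) (simp_all add: M_def fls_X_ideal_iff)
      show "(f x - a) * b \<in> fls_X_ideal N"
        by (rule mult[OF elim(1), of _ "fls_subdegree b"]) (simp_all add: M_def fls_X_ideal_iff)
    qed
    finally show ?case .
  qed
qed

instance fls :: (ab_group_add) topological_comm_monoid_add
proof
  fix a b :: "'a fls"
  show "LIM x (nhds a \<times>\<^sub>F nhds b). fst x + snd x :> nhds (a + b)"
    by (intro tendsto_fls_add filterlim_fst filterlim_snd)
qed

instance fls :: (comm_ring_1) topological_comm_monoid_mult
proof
  fix a b :: "'a fls"
  show "LIM x (nhds a \<times>\<^sub>F nhds b). fst x * snd x :> nhds (a * b)"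
    by (intro tendsto_fls_mult filterlim_fst filterlim_snd)
qed

lemma fls_convergentI:
  fixes h :: "'b \<Rightarrow> 'a::ab_group_add fls"
  assumes F: "F \<noteq> bot" and cauchy: "\<And>N. \<exists>c. eventually (\<lambda>x. h x - c \<in> fls_X_ideal N) F"
  shows "\<exists>l. (h \<longlongrightarrow> l) F"
proof -
  obtain c where c: "\<And>N. eventually (\<lambda>x. h x - c N \<in> fls_X_ideal N) F"
    using cauchy by metis
  have c_eq: "c M $$ k = c N $$ k" if "k < M" "k < N" for M N k
  proof -
    have "eventually (\<lambda>x. h x - c M \<in> fls_X_ideal M \<and> h x - c N \<in> fls_X_ideal N) F"
      using c by (simp add: eventually_conj)
    then obtain x where "h x - c M \<in> fls_X_ideal M" "h x - c N \<in> fls_X_ideal N"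
      using eventually_happens'[OF F] by blast
    with that show ?thesis
      by (metis fls_X_ideal_diff_nth)
  qed
  define l where "l = Abs_fls (\<lambda>k. c (k + 1) $$ k)"
  have "c (k + 1) $$ k = 0" if "k < min 0 (fls_subdegree (c 0))" for k
    using c_eq[of k "k + 1" 0] that by (simp add: fls_eq0_below_subdegree)
  then have l_nth: "l $$ k = c (k + 1) $$ k" for k
    unfolding l_def by (intro nth_Abs_fls_lower_bound) blast
  have "eventually (\<lambda>x. h x - l \<in> fls_X_ideal N) F" for N
    using c[of N]
  proof eventually_elim
    case (elim x)
    then have "h x $$ k = l $$ k" if "k < N" for k
      using that c_eq[of k N "k + 1"] fls_X_ideal_diff_nth[of "h x"] by (simp add: l_nth)
    then show ?case
      by (simp add: fls_X_ideal_def)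
  qed
  then show ?thesis
    by (auto simp: tendsto_fls_iff)
qed

lemma tendsto_poly_eval:
  fixes s :: "'b \<Rightarrow> 'v \<Rightarrow> 'a::comm_ring_1 fls"
  assumes "\<And>v. ((\<lambda>x. s x v) \<longlongrightarrow> t v) F"
  shows "((\<lambda>x. poly_eval (s x) P) \<longlongrightarrow> poly_eval t P) F"
  unfolding poly_eval_def mono_eval_def by (intro tendsto_intros assms)

lemma tendsto_witt_mult:
  fixes x y :: "'b \<Rightarrow> nat \<Rightarrow> 'a::comm_ring_1 fls"
  assumes "\<And>n. ((\<lambda>i. x i n) \<longlongrightarrow> a n) F" "\<And>n. ((\<lambda>i. y i n) \<longlongrightarrow> b n) F"
  shows "((\<lambda>i. (x i \<otimes>\<^bsub>witt_ring p\<^esub> y i) n) \<longlongrightarrow> (a \<otimes>\<^bsub>witt_ring p\<^esub> b) n) F"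
  unfolding witt_mult_nth
  by (rule tendsto_poly_eval) (use assms in \<open>auto split: sum.split\<close>)


section \<open>Congruences between integral Witt vectors\<close>

definition fls_icong :: "int \<Rightarrow> 'a::comm_ring_1 fls \<Rightarrow> 'a fls \<Rightarrow> bool" where
  "fls_icong N f g \<longleftrightarrow> f \<in> fls_X_ideal 0 \<and> g \<in> fls_X_ideal 0 \<and> f - g \<in> fls_X_ideal N"

lemma fls_icong_antimono: "fls_icong N f g \<Longrightarrow> M \<le> N \<Longrightarrow> fls_icong M f g"
  using fls_X_ideal_antimono[of M N] by (auto simp: fls_icong_def)

lemma fls_icong_sym: "fls_icong N f g \<Longrightarrow> fls_icong N g f"
  by (auto simp: fls_icong_def fls_X_ideal_def)

lemma fls_icong_add: "fls_icong N f f' \<Longrightarrow> fls_icong N g g' \<Longrightarrow> fls_icong N (f + g) (f' + g')"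
  by (simp add: fls_icong_def fls_X_ideal_def)

lemma fls_icong_mult:
  assumes "fls_icong N f f'" "fls_icong N g g'"
  shows "fls_icong N (f * g) (f' * g')"
proof -
  have f: "f \<in> fls_X_ideal 0" "f' \<in> fls_X_ideal 0" "f - f' \<in> fls_X_ideal N"
    and g: "g \<in> fls_X_ideal 0" "g' \<in> fls_X_ideal 0" "g - g' \<in> fls_X_ideal N"
    using assms by (simp_all add: fls_icong_def)
  have "f * g - f' * g' = (f - f') * g + f' * (g - g')"
    by (simp add: algebra_simps)
  also have "\<dots> \<in> fls_X_ideal N"
    using fls_X_ideal_mult[OF f(3) g(1)] fls_X_ideal_mult[OF f(2) g(3)]
    by (auto intro: fls_X_ideal_add)
  finally show ?thesis
    using fls_X_ideal_mult[OF f(1) g(1)] fls_X_ideal_mult[OF f(2) g(2)]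
    by (simp add: fls_icong_def)
qed

lemma fls_icong_of_int: "fls_icong N (of_int c) (of_int c)"
  by (simp add: fls_icong_def fls_X_ideal_def fls_of_int)

lemma fls_icong_0: "fls_icong N 0 0"
  using fls_icong_of_int[of N 0] by simp

lemma fls_icong_1: "fls_icong N 1 1"
  using fls_icong_of_int[of N 1] by simp

lemma fls_icong_power: "fls_icong N f g \<Longrightarrow> fls_icong N (f ^ n) (g ^ n)"
  by (induction n) (auto intro: fls_icong_mult fls_icong_1)

lemma fls_icong_sum:
  "(\<And>i. i \<in> A \<Longrightarrow> fls_icong N (f i) (g i)) \<Longrightarrow> fls_icong N (\<Sum>i\<in>A. f i) (\<Sum>i\<in>A. g i)"
  by (induction A rule: infinite_finite_induct) (auto intro: fls_icong_add fls_icong_0)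

lemma fls_icong_prod:
  "(\<And>i. i \<in> A \<Longrightarrow> fls_icong N (f i) (g i)) \<Longrightarrow> fls_icong N (\<Prod>i\<in>A. f i) (\<Prod>i\<in>A. g i)"
  by (induction A rule: infinite_finite_induct) (auto intro: fls_icong_mult fls_icong_1)

lemma fls_icong_prod_1:
  "(\<And>i. i \<in> A \<Longrightarrow> fls_icong N (f i) 1) \<Longrightarrow> fls_icong N (\<Prod>i\<in>A. f i) 1"
  using fls_icong_prod[of A N f "\<lambda>_. 1"] by simp

lemma fls_icong_poly_eval:
  assumes "\<And>v. fls_icong N (s v) (t v)"
  shows "fls_icong N (poly_eval s P) (poly_eval t P)"
  unfolding poly_eval_def mono_eval_def
  by (intro fls_icong_sum fls_icong_mult fls_icong_of_int fls_icong_prod fls_icong_power assms)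

lemma fls_icong_1_nonzero: "fls_icong 1 f 1 \<Longrightarrow> f \<noteq> 0"
  by (auto simp: fls_icong_def fls_X_ideal_iff)

lemma fls_icong_tendsto:
  assumes "F \<noteq> bot" "(f \<longlongrightarrow> l) F" "eventually (\<lambda>x. fls_icong N (f x) g) F"
  shows "fls_icong N l g"
proof -
  have "eventually (\<lambda>x. f x - l \<in> fls_X_ideal (max N 0)) F"
    using assms(2) by (simp add: tendsto_fls_iff)
  then have "eventually (\<lambda>x. fls_icong N (f x) g \<and> f x - l \<in> fls_X_ideal (max N 0)) F"
    using assms(3) by (simp add: eventually_conj)
  then obtain x where "fls_icong N (f x) g" "f x - l \<in> fls_X_ideal (max N 0)"
    using eventually_happens'[OF assms(1)] by blast
  then show ?thesis
    by (simp add: fls_icong_def fls_X_ideal_def)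
qed

definition witt_icong :: "int \<Rightarrow> (nat \<Rightarrow> 'a::comm_ring_1 fls) \<Rightarrow> (nat \<Rightarrow> 'a fls) \<Rightarrow> bool" where
  "witt_icong N x y \<longleftrightarrow> (\<forall>n. fls_icong N (x n) (y n))"

lemma witt_icong_refl: "witt_icong M x y \<Longrightarrow> witt_icong N x x"
  by (simp add: witt_icong_def fls_icong_def fls_X_ideal_def)

lemma witt_icong_mult:
  "witt_icong N x x' \<Longrightarrow> witt_icong N y y' \<Longrightarrow>
    witt_icong N (x \<otimes>\<^bsub>witt_ring p\<^esub> y) (x' \<otimes>\<^bsub>witt_ring p\<^esub> y')"
  unfolding witt_icong_def witt_mult_nth
  by (intro allI fls_icong_poly_eval) (auto split: sum.split)

lemma witt_icong_teichmueller:
  "witt_icong N (teichmueller f) (teichmueller g) \<longleftrightarrow> fls_icong N f g"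
  by (auto simp: witt_icong_def teichmueller_def fls_icong_0)

context witt_vectors
begin

lemma witt_icong_finprod_one:
  assumes "\<And>i. i \<in> F \<Longrightarrow> witt_icong N (f i) \<one>\<^bsub>W\<^esub>"
  shows "witt_icong N (finprod W f F) \<one>\<^bsub>W\<^esub>"
  using assms
proof (induction F rule: infinite_finite_induct)
  case (insert i F)
  then have "witt_icong N (f i \<otimes>\<^bsub>W\<^esub> finprod W f F) (\<one>\<^bsub>W\<^esub> \<otimes>\<^bsub>W\<^esub> \<one>\<^bsub>W\<^esub>)"
    by (intro witt_icong_mult) auto
  with insert show ?case
    by simp
qed (simp_all add: witt_one_eq_teichmueller witt_icong_teichmueller fls_icong_1)


lemma witt_icong_nat_pow_one:
  "witt_icong N x \<one>\<^bsub>W\<^esub> \<Longrightarrow> witt_icong N (x [^]\<^bsub>W\<^esub> (k :: nat)) \<one>\<^bsub>W\<^esub>"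
  by (simp add: nat_pow_eq_finprod witt_icong_finprod_one)

lemma witt_icong_finprod_subset:
  assumes F: "finite F" "E \<subseteq> F"
    and integral: "\<And>i. i \<in> E \<Longrightarrow> witt_icong 0 (f i) \<one>\<^bsub>W\<^esub>"
    and one: "\<And>i. i \<in> F - E \<Longrightarrow> witt_icong N (f i) \<one>\<^bsub>W\<^esub>"
  shows "witt_icong N (finprod W f F) (finprod W f E)"
proof -
  have "witt_icong N (finprod W f E) (finprod W f E)"
    using integral by (rule witt_icong_refl[OF witt_icong_finprod_one])
  moreover have "witt_icong N (finprod W f (F - E)) \<one>\<^bsub>W\<^esub>"
    using one by (rule witt_icong_finprod_one)
  ultimately have "witt_icong N (finprod W f E \<otimes>\<^bsub>W\<^esub> finprod W f (F - E))
      (finprod W f E \<otimes>\<^bsub>W\<^esub> \<one>\<^bsub>W\<^esub>)"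
    by (rule witt_icong_mult)
  then show ?thesis
    using F by (simp add: finprod_subset_diff)
qed


section \<open>Convergence of infinite products\<close>

definition tends_to_one :: "('i \<Rightarrow> nat \<Rightarrow> 'a::comm_ring_1 fls) \<Rightarrow> 'i set \<Rightarrow> bool" where
  "tends_to_one f I \<longleftrightarrow> (\<forall>N. finite {i\<in>I. \<not> witt_icong N (f i) \<one>\<^bsub>W\<^esub>})"

lemma tends_to_one_subset: "tends_to_one f I \<Longrightarrow> J \<subseteq> I \<Longrightarrow> tends_to_one f J"
  unfolding tends_to_one_def by (auto elim!: finite_subset[rotated])

definition finprod_tendsto ::
  "('i \<Rightarrow> nat \<Rightarrow> 'a::comm_ring_1 fls) \<Rightarrow> 'i set \<Rightarrow> (nat \<Rightarrow> 'a fls) \<Rightarrow> bool" where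
  "finprod_tendsto f I y \<longleftrightarrow>
     (\<forall>n. ((\<lambda>F. finprod W f F n) \<longlongrightarrow> y n) (finite_subsets_at_top I))"

lemma witt_has_prod_iff:
  "witt_has_prod p f I y \<longleftrightarrow> f ` I \<subseteq> Units W \<and> y \<in> Units W \<and> finprod_tendsto f I y"
  by (simp add: witt_has_prod_def finprod_tendsto_def)

lemma integral_finprod_convergent:
  fixes f :: "'i \<Rightarrow> nat \<Rightarrow> 'a::comm_ring_1 fls"
  assumes f: "tends_to_one f I" and integral: "\<And>i. i \<in> I \<Longrightarrow> witt_icong 0 (f i) \<one>\<^bsub>W\<^esub>"
  shows "\<exists>y. finprod_tendsto f I y"
proof -
  have "\<exists>l. ((\<lambda>F. finprod W f F n) \<longlongrightarrow> l) (finite_subsets_at_top I)" for n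
  proof (rule fls_convergentI)
    fix N
    define E where "E = {i\<in>I. \<not> witt_icong N (f i) \<one>\<^bsub>W\<^esub>}"
    have E: "finite E" "E \<subseteq> I"
      using f by (auto simp: E_def tends_to_one_def)
    have "finprod W f F n - finprod W f E n \<in> fls_X_ideal N"
      if F: "finite F" "E \<subseteq> F" "F \<subseteq> I" for F
    proof -
      have "witt_icong N (finprod W f F) (finprod W f E)"
        using F integral by (intro witt_icong_finprod_subset) (auto simp: E_def)
      then show ?thesis
        by (simp add: witt_icong_def fls_icong_def)
    qed
    then show "\<exists>c. eventually (\<lambda>F. finprod W f F n - c \<in> fls_X_ideal N) (finite_subsets_at_top I)"
      using E unfolding eventually_finite_subsets_at_top by blast
  qed simp
  then show ?thesis
    unfolding finprod_tendsto_def by metis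
qed

text \<open>The finitely many factors with poles do no harm because multiplication is continuous.\<close>

lemma finprod_convergent:
  fixes f :: "'i \<Rightarrow> nat \<Rightarrow> 'a::comm_ring_1 fls"
  assumes f: "tends_to_one f I"
  shows "\<exists>y. finprod_tendsto f I y"
proof -
  define E where "E = {i\<in>I. \<not> witt_icong 0 (f i) \<one>\<^bsub>W\<^esub>}"
  have E: "finite E" "E \<subseteq> I"
    using f by (auto simp: E_def tends_to_one_def)
  have "\<exists>z. finprod_tendsto f (I - E) z"
    by (rule integral_finprod_convergent[OF tends_to_one_subset[OF f]]) (auto simp: E_def)
  then obtain z where z: "((\<lambda>F. finprod W f F n) \<longlongrightarrow> z n) (finite_subsets_at_top (I - E))" for n
    unfolding finprod_tendsto_def by blast
  have "filterlim (\<lambda>F. F - E) (finite_subsets_at_top (I - E)) (finite_subsets_at_top I)"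
    unfolding filterlim_finite_subsets_at_top
    by (auto simp: eventually_finite_subsets_at_top)
  from filterlim_compose[OF z this]
  have lim: "((\<lambda>F. (finprod W f E \<otimes>\<^bsub>W\<^esub> finprod W f (F - E)) n) \<longlongrightarrow>
      (finprod W f E \<otimes>\<^bsub>W\<^esub> z) n) (finite_subsets_at_top I)" for n
    by (intro tendsto_witt_mult tendsto_const)
  have "eventually (\<lambda>F. (finprod W f E \<otimes>\<^bsub>W\<^esub> finprod W f (F - E)) n = finprod W f F n)
      (finite_subsets_at_top I)" for n
    unfolding eventually_finite_subsets_at_top
    using E by (intro exI[of _ E]) (simp flip: finprod_subset_diff)
  from Lim_transform_eventually[OF lim this] show ?thesis
    unfolding finprod_tendsto_def by blast
qed

lemma witt_has_prod_one_plus_V: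
  fixes f :: "'i \<Rightarrow> nat \<Rightarrow> 'k::field fls"
  assumes char: "of_nat p = (0 :: 'k fls)" and "tends_to_one f I"
    and m: "0 < m" and f: "\<And>i. i \<in> I \<Longrightarrow> f i \<in> one_plus_V m"
    and lim: "((\<lambda>F. \<Sum>i\<in>F. f i m) \<longlongrightarrow> s) (finite_subsets_at_top I)"
  shows "\<exists>y \<in> one_plus_V m. y m = s \<and> witt_has_prod p f I y"
proof -
  obtain y where y: "((\<lambda>F. finprod W f F n) \<longlongrightarrow> y n) (finite_subsets_at_top I)" for n
    using finprod_convergent[OF assms(2)] unfolding finprod_tendsto_def by blast
  have limit_unique: "y n = l" if "(g \<longlongrightarrow> l) (finite_subsets_at_top I)"
    "\<And>F. F \<subseteq> I \<Longrightarrow> finprod W f F n = g F" for g n l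
  proof (rule tendsto_unique[OF _ y])
    show "((\<lambda>F. finprod W f F n) \<longlongrightarrow> l) (finite_subsets_at_top I)"
      by (rule Lim_transform_eventually[OF that(1)])
        (use that(2) in \<open>auto intro: eventually_finite_subsets_at_top_weakI\<close>)
  qed simp
  have "y i = \<one>\<^bsub>W\<^esub> i" if "i < m" for i
  proof (rule limit_unique[OF tendsto_const])
    fix F assume "F \<subseteq> I"
    then have "finprod W f F \<in> one_plus_V m"
      using f by (intro one_plus_V_finprod) auto
    with that show "finprod W f F i = \<one>\<^bsub>W\<^esub> i"
      by (simp add: one_plus_V_def)
  qed
  then have "y \<in> one_plus_V m"
    by (simp add: one_plus_V_def)
  moreover have "y m = s"
    by (rule limit_unique[OF lim]) (use f in \<open>auto intro!: one_plus_V_finprod_nth[OF char m]\<close>)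
  ultimately show ?thesis
    using f y one_plus_V_subset_Units[OF char m]
    by (auto simp: witt_has_prod_iff finprod_tendsto_def)
qed

end


section \<open>Unconditional products in a topological monoid\<close>

definition has_prod_on ::
  "('i \<Rightarrow> 'a::{comm_monoid_mult, topological_space}) \<Rightarrow> 'i set \<Rightarrow> 'a \<Rightarrow> bool" where
  "has_prod_on f I l \<longleftrightarrow> ((\<lambda>F. \<Prod>i\<in>F. f i) \<longlongrightarrow> l) (finite_subsets_at_top I)"

lemma has_prod_on_reindex:
  assumes \<phi>: "inj_on \<phi> A" and h: "has_prod_on h (\<phi> ` A) l"
  shows "has_prod_on (\<lambda>x. h (\<phi> x)) A l"
  unfolding has_prod_on_def
proof (rule Lim_transform_eventually)
  show "((\<lambda>F. \<Prod>y\<in>\<phi> ` F. h y) \<longlongrightarrow> l) (finite_subsets_at_top A)"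
    using h unfolding has_prod_on_def
    by (simp add: filterlim_filtermap flip: filtermap_image_finite_subsets_at_top[OF \<phi>])
  show "eventually (\<lambda>F. (\<Prod>y\<in>\<phi> ` F. h y) = (\<Prod>x\<in>F. h (\<phi> x))) (finite_subsets_at_top A)"
    by (rule eventually_finite_subsets_at_top_weakI)
      (simp add: prod.reindex[OF inj_on_subset[OF \<phi>]])
qed

lemma filterlim_Image_finite_subsets_at_top:
  assumes "i \<in> I"
  shows "filterlim (\<lambda>Y. Y `` {i}) (finite_subsets_at_top (J i)) (finite_subsets_at_top (Sigma I J))"
  unfolding filterlim_finite_subsets_at_top eventually_finite_subsets_at_top
proof (intro allI impI)
  fix Z assume "finite Z \<and> Z \<subseteq> J i"
  with assms show "\<exists>X. finite X \<and> X \<subseteq> Sigma I J \<and>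
      (\<forall>Y. finite Y \<and> X \<subseteq> Y \<and> Y \<subseteq> Sigma I J \<longrightarrow>
        finite (Y `` {i}) \<and> Z \<subseteq> Y `` {i} \<and> Y `` {i} \<subseteq> J i)"
    by (intro exI[of _ "{i} \<times> Z"]) auto
qed

lemma prod_prod_Image:
  assumes "finite F" "finite Y" "fst ` Y \<subseteq> F"
  shows "(\<Prod>i\<in>F. \<Prod>j\<in>Y `` {i}. f (i, j)) = (\<Prod>x\<in>Y. f x)"
proof -
  have "(\<Prod>i\<in>F. \<Prod>j\<in>Y `` {i}. f (i, j)) = (\<Prod>x\<in>(SIGMA i:F. Y `` {i}). f x)"
    using assms by (subst prod.Sigma) auto
  also have "(SIGMA i:F. Y `` {i}) = Y"
    using assms(3) by force
  finally show ?thesis .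
qed

lemma has_prod_on_Sigma:
  fixes f :: "'i \<times> 'j \<Rightarrow> 'a::{topological_comm_monoid_mult, t3_space}"
  assumes total: "has_prod_on f (Sigma I J) l"
    and inner: "\<And>i. i \<in> I \<Longrightarrow> has_prod_on (\<lambda>j. f (i, j)) (J i) (g i)"
  shows "has_prod_on g I l"
  unfolding has_prod_on_def
proof (rule topological_tendstoI)
  fix U assume "open U" "l \<in> U"
  from nhds_closed[OF \<open>l \<in> U\<close> \<open>open U\<close>]
  obtain C where C: "closed C" "C \<subseteq> U" "eventually (\<lambda>y. y \<in> C) (nhds l)"
    by blast
  have "eventually (\<lambda>F. (\<Prod>x\<in>F. f x) \<in> C) (finite_subsets_at_top (Sigma I J))"
    by (rule eventually_compose_filterlim[OF C(3) total[unfolded has_prod_on_def]])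
  then obtain X where X: "finite X" "X \<subseteq> Sigma I J"
    and in_C: "\<And>Y. finite Y \<Longrightarrow> X \<subseteq> Y \<Longrightarrow> Y \<subseteq> Sigma I J \<Longrightarrow> (\<Prod>x\<in>Y. f x) \<in> C"
    unfolding eventually_finite_subsets_at_top by metis
  have "(\<Prod>i\<in>F. g i) \<in> C" if F: "finite F" "fst ` X \<subseteq> F" "F \<subseteq> I" for F
  proof (rule Lim_in_closed_set[OF C(1)])
    show "((\<lambda>Y. \<Prod>i\<in>F. \<Prod>j\<in>Y `` {i}. f (i, j)) \<longlongrightarrow> (\<Prod>i\<in>F. g i)) (finite_subsets_at_top (Sigma F J))"
    proof (rule tendsto_prod')
      fix i assume "i \<in> F"
      with F(3) have "i \<in> I"
        by blast
      from filterlim_compose[OF inner[OF this, unfolded has_prod_on_def]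
          filterlim_Image_finite_subsets_at_top[OF \<open>i \<in> F\<close>, of J]]
      show "((\<lambda>Y. \<Prod>j\<in>Y `` {i}. f (i, j)) \<longlongrightarrow> g i) (finite_subsets_at_top (Sigma F J))" .
    qed
    show "eventually (\<lambda>Y. (\<Prod>i\<in>F. \<Prod>j\<in>Y `` {i}. f (i, j)) \<in> C) (finite_subsets_at_top (Sigma F J))"
      unfolding eventually_finite_subsets_at_top
    proof (intro exI[of _ X] conjI allI impI)
      fix Y assume Y: "finite Y \<and> X \<subseteq> Y \<and> Y \<subseteq> Sigma F J"
      then have "(\<Prod>i\<in>F. \<Prod>j\<in>Y `` {i}. f (i, j)) = (\<Prod>x\<in>Y. f x)"
        using F(1) by (intro prod_prod_Image) auto
      with Y F(3) show "(\<Prod>i\<in>F. \<Prod>j\<in>Y `` {i}. f (i, j)) \<in> C"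
        by (auto intro!: in_C)
    qed (use X F in force)+
  qed simp
  then show "eventually (\<lambda>F. (\<Prod>i\<in>F. g i) \<in> U) (finite_subsets_at_top I)"
    using X C(2) unfolding eventually_finite_subsets_at_top
    by (intro exI[of _ "fst ` X"]) auto
qed


section \<open>The prime field\<close>

lemma of_nat_CARD_fls: "of_nat CARD('a) = (0 :: 'a::{comm_ring_1,finite} fls)"
  by (simp add: of_nat_eq_0_iff_char_dvd CHAR_dvd_CARD)

lemma CHAR_eq_prime_CARD:
  assumes "prime CARD('a::{ring_1,finite})"
  shows "CHAR('a) = CARD('a)"
  using assms CHAR_dvd_CARD[where 'a = 'a] CHAR_not_1[where 'a = 'a]
  by (auto simp: prime_nat_iff)

lemma prime_field_of_nat:
  fixes a :: "'a::{ring_1,finite}"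
  assumes "prime CARD('a)"
  shows "\<exists>m<CARD('a). of_nat m = a"
proof -
  have "inj_on (of_nat :: nat \<Rightarrow> 'a) {..<CARD('a)}"
    by (auto simp: inj_on_def of_nat_eq_iff_cong_CHAR CHAR_eq_prime_CARD[OF assms] cong_def)
  then have "(of_nat :: nat \<Rightarrow> 'a) ` {..<CARD('a)} = UNIV"
    by (intro card_subset_eq) (auto simp: card_image)
  then show ?thesis
    by (metis UNIV_I imageE lessThan_iff)
qed

lemma prime_field_power:
  fixes a :: "'a::{comm_ring_1,finite}"
  assumes "prime CARD('a)"
  shows "a ^ (CARD('a) ^ k) = a"
proof -
  have "b ^ CARD('a) = b" for b :: 'a
  proof -
    obtain m where m: "b = of_int (int m)"
      using prime_field_of_nat[OF assms, of b] by auto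
    obtain q where "int m ^ CARD('a) - int m = int CARD('a) * q"
      using prime_dvd_int_power_diff[OF assms, of "int m"] by (elim dvdE)
    then have "b ^ CARD('a) - b = of_nat CARD('a) * of_int q"
      unfolding m by (metis of_int_diff of_int_mult of_int_of_nat_eq of_int_power)
    then show ?thesis
      by (simp flip: CHAR_eq_prime_CARD[OF assms])
  qed
  then show ?thesis
    by (induction k) (simp_all add: power_mult)
qed


section \<open>Expansion of a principal unit of the power series ring\<close>

definition unit_monom :: "'a::comm_ring_1 \<Rightarrow> nat \<Rightarrow> 'a fls" where
  "unit_monom c n = 1 - fls_const c * fls_X ^ n"

lemma fls_icong_unit_monom: "fls_icong (int n) (unit_monom c n) 1"
  by (auto simp: fls_icong_def fls_X_ideal_def unit_monom_def)

lemma unit_monom_nonzero: "0 < n \<Longrightarrow> unit_monom c n \<noteq> 0"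
  using fls_icong_antimono[OF fls_icong_unit_monom, of 1 n c] by (intro fls_icong_1_nonzero) simp

lemma unit_monom_power_prime_power:
  fixes c :: "'a::{comm_ring_1,finite}"
  assumes "prime CARD('a)"
  shows "unit_monom c j ^ (CARD('a) ^ k) = unit_monom c (j * CARD('a) ^ k)"
proof -
  let ?z = "fls_const c * fls_X ^ j" and ?q = "CARD('a) ^ k"
  have "(unit_monom c j + ?z) ^ ?q = unit_monom c j ^ ?q + ?z ^ ?q"
    using assms CHAR_eq_prime_CARD[OF assms] by (intro freshmans_dream'[of _ k]) simp_all
  moreover have "unit_monom c j + ?z = 1"
    by (simp add: unit_monom_def)
  moreover have "?z ^ ?q = fls_const c * fls_X ^ (j * ?q)"
    by (simp add: power_mult_distrib prime_field_power[OF assms]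
        flip: fls_const_power power_mult)
  ultimately show ?thesis
    by (simp add: unit_monom_def algebra_simps)
qed

lemma mult_unit_monom_nth: "(f * unit_monom c n) $$ k = f $$ k - c * f $$ (k - int n)"
proof -
  have "f * unit_monom c n = f - fls_const c * (fls_X ^ n * f)"
    by (simp add: unit_monom_def algebra_simps)
  then show ?thesis
    by (simp add: fls_X_power_times_conv_shift)
qed

lemma fls_icong_mult_unit_monom:
  assumes f: "fls_icong 1 f 1" and g: "fls_icong (int n) f g" and n: "0 < n"
  shows "fls_icong (int (Suc n)) (f * unit_monom (f $$ int n - g $$ int n) n) g"
proof -
  have f0: "f $$ 0 = 1" "f $$ k = 0" if "k < 0" for k
    using f that by (auto simp: fls_icong_def fls_X_ideal_def)
  have "f $$ k = g $$ k" if "k < int n" for k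
    using g that by (auto simp: fls_icong_def intro: fls_X_ideal_diff_nth)
  then show ?thesis
    using f g n f0 by (auto simp: fls_icong_def fls_X_ideal_def mult_unit_monom_nth less_Suc_eq)
qed

lemma partial_products_unit_monom:
  assumes g: "fls_icong 1 g 1"
  shows "\<exists>a. \<forall>N. fls_icong (int (Suc N)) (\<Prod>n\<in>{1..N}. unit_monom (a n) n) g"
proof -
  define P where "P a N = (\<Prod>n\<in>{1..N}. unit_monom (a n) n)" for a :: "nat \<Rightarrow> 'a" and N
  have P1: "fls_icong 1 (P a N) 1" for a N
    unfolding P_def
    by (intro fls_icong_prod_1) (auto intro: fls_icong_antimono[OF fls_icong_unit_monom])
  have "\<exists>a. \<forall>n. a n = P a (n - 1) $$ int n - g $$ int n"
  proof (rule dependent_wellorder_choice)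
    fix r and a b :: "nat \<Rightarrow> 'a" and n
    assume "\<And>m. m < n \<Longrightarrow> a m = b m"
    then have "P a (n - 1) = P b (n - 1)"
      unfolding P_def by (intro prod.cong) auto
    then show "(r = P a (n - 1) $$ int n - g $$ int n) = (r = P b (n - 1) $$ int n - g $$ int n)"
      by simp
  qed simp
  then obtain a where a: "\<And>n. a n = P a (n - 1) $$ int n - g $$ int n"
    by blast
  have "fls_icong (int (Suc N)) (P a N) g" for N
  proof (induction N)
    case 0
    then show ?case
      using g by (simp add: P_def fls_icong_sym)
  next
    case (Suc N)
    have "P a (Suc N) = P a N * unit_monom (a (Suc N)) (Suc N)"
      by (simp add: P_def mult.commute)
    with fls_icong_mult_unit_monom[OF P1 Suc] show ?case
      by (simp add: a[of "Suc N"])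
  qed
  then show ?thesis
    by (auto simp: P_def)
qed

lemma principal_unit_expansion:
  assumes "fls_icong 1 g 1"
  shows "\<exists>a. has_prod_on (\<lambda>n. unit_monom (a n) n) {1..} g"
proof -
  obtain a where a: "\<And>N. fls_icong (int (Suc N)) (\<Prod>n\<in>{1..N}. unit_monom (a n) n) g"
    using partial_products_unit_monom[OF assms] by blast
  have "has_prod_on (\<lambda>n. unit_monom (a n) n) {1..} g"
    unfolding has_prod_on_def tendsto_fls_iff eventually_finite_subsets_at_top
  proof (intro allI exI conjI impI)
    fix N :: int and F
    let ?M = "nat N"
    assume F: "finite F \<and> {1..?M} \<subseteq> F \<and> F \<subseteq> {1..}"
    have "fls_icong N (\<Prod>n\<in>F - {1..?M}. unit_monom (a n) n) 1"
    proof (intro fls_icong_prod_1 fls_icong_antimono[OF fls_icong_unit_monom])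
      fix n assume "n \<in> F - {1..?M}"
      with F show "N \<le> int n"
        by fastforce
    qed
    moreover have "fls_icong N (\<Prod>n\<in>{1..?M}. unit_monom (a n) n) g"
      by (rule fls_icong_antimono[OF a]) simp
    ultimately have "fls_icong N
        ((\<Prod>n\<in>F - {1..?M}. unit_monom (a n) n) * (\<Prod>n\<in>{1..?M}. unit_monom (a n) n)) (1 * g)"
      by (rule fls_icong_mult)
    moreover have "(\<Prod>n\<in>F. unit_monom (a n) n) =
        (\<Prod>n\<in>F - {1..?M}. unit_monom (a n) n) * (\<Prod>n\<in>{1..?M}. unit_monom (a n) n)"
      using F by (intro prod.subset_diff) auto
    ultimately show "(\<Prod>n\<in>F. unit_monom (a n) n) - g \<in> fls_X_ideal N"
      by (simp add: fls_icong_def)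
  qed auto
  then show ?thesis
    by blast
qed

lemma fls_eq_const_X_power_principal_unit:
  fixes f :: "'a::field fls"
  assumes "f \<noteq> 0"
  obtains c g where "c \<noteq> 0" "f = fls_const c * fls_X powi fls_subdegree f * g" "fls_icong 1 g 1"
proof
  let ?c = "f $$ fls_subdegree f" and ?b = "fls_base_factor f"
  let ?g = "fls_const (inverse ?c) * ?b"
  show c: "?c \<noteq> 0"
    using assms by simp
  have "fls_const ?c * fls_X powi fls_subdegree f * ?g =
      (fls_const ?c * fls_const (inverse ?c)) * (fls_X powi fls_subdegree f * ?b)"
    by (simp add: mult_ac)
  also have "\<dots> = f"
    using c by (simp add: fls_X_intpow_times_conv_shift fls_const_mult_const)
  finally show "f = fls_const ?c * fls_X powi fls_subdegree f * ?g" ..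
  show "fls_icong 1 ?g 1"
    using c by (auto simp: fls_icong_def fls_X_ideal_def)
qed


section \<open>The Teichmueller factor\<close>

lemma bij_betw_coprime_times_prime_power:
  assumes p: "prime p"
  shows "bij_betw (\<lambda>(k, j). j * p ^ k) (UNIV \<times> {j. 0 < j \<and> coprime j p}) {1::nat..}"
proof -
  have coprime_iff: "coprime j p \<longleftrightarrow> \<not> p dvd j" for j
    using p by (metis coprime_absorb_right coprime_commute not_prime_unit prime_imp_coprime)
  have "inj_on (\<lambda>(k, j). j * p ^ k) (UNIV \<times> {j. 0 < j \<and> coprime j p})"
  proof (rule inj_onI, clarify)
    fix k j k' j' assume j: "coprime j p" "coprime j' p" and eq: "j * p ^ k = j' * p ^ k'"
    show "k = k' \<and> j = j'"
      by (rule prime_power_cancel2[OF p eq]) (use j in \<open>simp_all add: coprime_iff\<close>)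
  qed
  moreover have "n \<in> (\<lambda>(k, j). j * p ^ k) ` (UNIV \<times> {j. 0 < j \<and> coprime j p})"
    if n: "0 < n" for n
  proof -
    obtain k j where "\<not> p dvd j" "n = j * p ^ k"
      using prime_power_canonical[OF p n] by blast
    with n show ?thesis
      by (intro image_eqI[of _ _ "(k, j)"]) (auto simp: coprime_iff)
  qed
  ultimately show ?thesis
    using prime_gt_0_nat[OF p] by (auto simp: bij_betw_def)
qed

context witt_vectors
begin

lemma witt_has_prod_teichmueller:
  fixes g :: "'i \<Rightarrow> 'k::field fls"
  assumes char: "of_nat p = (0 :: 'k fls)"
    and prod: "has_prod_on g I l"
    and "\<And>i. i \<in> I \<Longrightarrow> g i \<noteq> 0" and "l \<noteq> 0"
  shows "witt_has_prod p (\<lambda>i. teichmueller (g i)) I (teichmueller l)"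
proof -
  have "((\<lambda>F. teichmueller (\<Prod>i\<in>F. g i) n) \<longlongrightarrow> teichmueller l n) (finite_subsets_at_top I)" for n
    using prod by (simp add: has_prod_on_def teichmueller_def)
  moreover have "teichmueller f \<in> Units W" if "f \<noteq> 0" for f :: "'k fls"
    using that by (simp add: Units_witt_ring_iff[OF char] teichmueller_def dvd_field_iff)
  ultimately show ?thesis
    using assms(3,4) by (auto simp: witt_has_prod_iff finprod_tendsto_def finprod_teichmueller)
qed

lemma teichmueller_tends_to_one_imp_ex_has_prod_on:
  fixes g :: "'i \<Rightarrow> 'a::comm_ring_1 fls"
  assumes "tends_to_one (\<lambda>i. teichmueller (g i)) I"
  shows "\<exists>l. has_prod_on g I l"
proof -
  obtain y where "finprod_tendsto (\<lambda>i. teichmueller (g i)) I y"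
    using finprod_convergent[OF assms] by blast
  then have "((\<lambda>F. teichmueller (\<Prod>i\<in>F. g i) 0) \<longlongrightarrow> y 0) (finite_subsets_at_top I)"
    by (simp only: finprod_tendsto_def finprod_teichmueller)
  then show ?thesis
    by (auto simp: has_prod_on_def teichmueller_def)
qed

lemma ex_has_prod_on_unit_monom:
  fixes c :: "nat \<Rightarrow> 'a::comm_ring_1" and w :: "nat \<Rightarrow> nat"
  assumes w: "\<And>j. j \<in> J \<Longrightarrow> j \<le> w j"
  shows "\<exists>l. has_prod_on (\<lambda>j. unit_monom (c j) (w j)) J l"
proof (rule teichmueller_tends_to_one_imp_ex_has_prod_on)
  have "{j\<in>J. \<not> fls_icong N (unit_monom (c j) (w j)) 1} \<subseteq> {..<nat N}" for N
    using w fls_icong_antimono[OF fls_icong_unit_monom, of N] by force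
  then show "tends_to_one (\<lambda>j. teichmueller (unit_monom (c j) (w j))) J"
    by (auto simp: tends_to_one_def witt_one_eq_teichmueller witt_icong_teichmueller
        intro: finite_subset)
qed

lemma principal_unit_coprime_expansion:
  fixes g :: "'a::comm_ring_1 fls"
  assumes g: "fls_icong 1 g 1"
  obtains c l where
    "\<And>k. has_prod_on (\<lambda>j. unit_monom (c j k) (j * p ^ k)) {j. 0 < j \<and> coprime j p} (l k)"
    "\<And>k. fls_icong 1 (l k) 1"
    "has_prod_on l {0..} g"
proof -
  let ?J = "{j. 0 < j \<and> coprime j p}"
  have p: "0 < p"
    using prime_p prime_gt_0_nat by blast
  obtain a where a: "has_prod_on (\<lambda>n. unit_monom (a n) n) {1..} g"
    using principal_unit_expansion[OF g] by blast
  define h where "h k j = unit_monom (a (j * p ^ k)) (j * p ^ k)" for k j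
  have "\<exists>l. has_prod_on (h k) ?J l" for k
    unfolding h_def using p by (intro ex_has_prod_on_unit_monom) simp
  then obtain l where l: "has_prod_on (h k) ?J (l k)" for k
    by metis
  have "fls_icong 1 (l k) 1" for k
  proof (rule fls_icong_tendsto[OF _ l[unfolded has_prod_on_def]])
    have "fls_icong 1 (h k j) 1" if "0 < j" for j
      unfolding h_def using that p
      by (intro fls_icong_antimono[OF fls_icong_unit_monom]) (simp flip: of_nat_mult of_nat_power)
    then show "eventually (\<lambda>F. fls_icong 1 (\<Prod>j\<in>F. h k j) 1) (finite_subsets_at_top ?J)"
      by (intro eventually_finite_subsets_at_top_weakI fls_icong_prod_1) auto
  qed simp
  moreover have "has_prod_on (\<lambda>(k, j). h k j) ({0..} \<times> ?J) g"
    using bij_betw_coprime_times_prime_power[OF prime_p] a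
      has_prod_on_reindex[of "\<lambda>(k, j). j * p ^ k" "UNIV \<times> ?J" "\<lambda>n. unit_monom (a n) n" g]
    by (simp add: bij_betw_def h_def case_prod_unfold)
  from has_prod_on_Sigma[OF this] l have "has_prod_on l {0..} g"
    by simp
  ultimately show ?thesis
    using that[of "\<lambda>j k. a (j * p ^ k)" l] l by (simp add: h_def[abs_def])
qed

lemma teichmueller_principal_unit_expansion:
  fixes g :: "'k::{field,finite} fls"
  assumes card: "CARD('k) = p" and g: "fls_icong 1 g 1"
  obtains c P where
    "\<And>k. witt_has_prod p
       (\<lambda>j. teichmueller (1 - fls_const (c j k) * fls_X ^ j) [^]\<^bsub>W\<^esub> (p ^ k))
       {j. 0 < j \<and> coprime j p} (P k)"
    "witt_has_prod p P {0..} (teichmueller g)"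
proof -
  note char = of_nat_CARD_fls[where 'a = 'k, unfolded card]
  obtain c l where l: "\<And>k. has_prod_on (\<lambda>j. unit_monom (c j k) (j * p ^ k))
      {j. 0 < j \<and> coprime j p} (l k)" "\<And>k. fls_icong 1 (l k) 1"
    and prod_l: "has_prod_on l {0..} g"
    by (rule principal_unit_coprime_expansion[OF g]) blast
  have "teichmueller (1 - fls_const (c j k) * fls_X ^ j) [^]\<^bsub>W\<^esub> (p ^ k) =
      teichmueller (unit_monom (c j k) (j * p ^ k))" for j k
    using unit_monom_power_prime_power[of "c j k" j k] card prime_p
    by (simp add: teichmueller_nat_pow unit_monom_def)
  moreover have "witt_has_prod p (\<lambda>j. teichmueller (unit_monom (c j k) (j * p ^ k)))
      {j. 0 < j \<and> coprime j p} (teichmueller (l k))" for k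
    using prime_gt_0_nat[OF prime_p]
    by (intro witt_has_prod_teichmueller[OF char] l fls_icong_1_nonzero unit_monom_nonzero) auto
  moreover have "witt_has_prod p (\<lambda>k. teichmueller (l k)) {0..} (teichmueller g)"
    by (intro witt_has_prod_teichmueller[OF char prod_l] fls_icong_1_nonzero l g)
  ultimately show ?thesis
    by (intro that[of c "\<lambda>k. teichmueller (l k)"]) simp_all
qed

end


section \<open>The elements \<open>u\<^bsub>m,n\<^esub>\<close>\<close>

lemma tendsto_fls_monomial_sum:
  fixes f :: "'a::field fls"
  assumes b: "b \<le> fls_subdegree f"
  shows "((\<lambda>F. \<Sum>i\<in>F. fls_const (f $$ i) * fls_X powi i) \<longlongrightarrow> f) (finite_subsets_at_top {b..})"
  unfolding tendsto_fls_iff eventually_finite_subsets_at_top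
proof (intro allI exI conjI impI)
  fix N F
  assume F: "finite F \<and> {b..<N} \<subseteq> F \<and> F \<subseteq> {b..}"
  have "(\<Sum>i\<in>F. fls_const (f $$ i) * fls_X powi i) $$ k = f $$ k" if "k < N" for k
  proof -
    have "(\<Sum>i\<in>F. fls_const (f $$ i) * fls_X powi i) $$ k = (\<Sum>i\<in>F. if i = k then f $$ i else 0)"
      unfolding fls_nth_sum by (intro sum.cong) auto
    also have "\<dots> = (if k \<in> F then f $$ k else 0)"
      using F by simp
    also have "\<dots> = f $$ k"
    proof (cases "k \<in> F")
      case False
      with F that have "k < b"
        by (meson atLeastLessThan_iff not_le subset_iff)
      with b False show ?thesis
        by (simp add: fls_eq0_below_subdegree)
    qed simp
    finally show ?thesis .
  qed
  then show "(\<Sum>i\<in>F. fls_const (f $$ i) * fls_X powi i) - f \<in> fls_X_ideal N"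
    by (simp add: fls_X_ideal_def)
qed auto

lemma verschiebung_funpow_nth:
  "(verschiebung ^^ k) x n = (if n < k then 0 else x (n - k))"
  by (induction k arbitrary: n) (auto simp: verschiebung_def split: nat.split)

context witt_vectors
begin

lemma witt_u_eq:
  assumes "2 \<le> n"
  shows "witt_u p m n = \<one>\<^bsub>W\<^esub>(n - 1 := (fls_X powi m :: 'k::field fls))"
proof -
  have "witt_u p m n =
      (\<lambda>i. \<one>\<^bsub>W\<^esub> i + (verschiebung ^^ (n - 1)) (teichmueller (fls_X powi m :: 'k fls)) i)"
    unfolding witt_u_def using assms
    by (intro witt_add_disjoint) (auto simp: witt_one_nth verschiebung_funpow_nth)
  with assms show ?thesis
    by (auto simp: fun_eq_iff witt_one_nth verschiebung_funpow_nth teichmueller_def)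
qed

lemma witt_icong_witt_u:
  assumes "2 \<le> n" "N \<le> m" "0 \<le> m"
  shows "witt_icong N (witt_u p m n :: nat \<Rightarrow> 'k::field fls) \<one>\<^bsub>W\<^esub>"
  using assms
  by (auto simp: witt_u_eq witt_icong_def witt_one_nth fls_icong_def fls_X_ideal_def)

lemma tends_to_one_witt_u_power:
  assumes "2 \<le> n"
  shows "tends_to_one (\<lambda>m. witt_u p m n [^]\<^bsub>W\<^esub> (e m :: nat) :: nat \<Rightarrow> 'k::field fls) {b..}"
    (is "tends_to_one ?v _")
  unfolding tends_to_one_def
proof
  fix N
  have "witt_icong N (?v m) \<one>\<^bsub>W\<^esub>" if "max N 0 \<le> m" for m
    using that assms by (intro witt_icong_nat_pow_one witt_icong_witt_u) auto
  then have "{m\<in>{b..}. \<not> witt_icong N (?v m) \<one>\<^bsub>W\<^esub>} \<subseteq> {b..<max N 0}"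
    by (auto simp flip: not_le)
  then show "finite {m\<in>{b..}. \<not> witt_icong N (?v m) \<one>\<^bsub>W\<^esub>}"
    by (rule finite_subset) simp
qed

definition witt_u_product :: "nat \<Rightarrow> (nat \<Rightarrow> 'k::field fls) \<Rightarrow> bool" where
  "witt_u_product n q \<longleftrightarrow> (\<exists>e b. (\<forall>m. e m \<in> {0..p - 1}) \<and>
     witt_has_prod p (\<lambda>m. witt_u p m n [^]\<^bsub>W\<^esub> (e m :: nat)) {b..} q)"

lemma ex_witt_u_product_nth:
  fixes f :: "'k::{field,finite} fls"
  assumes card: "CARD('k) = p" and n: "2 \<le> n"
  shows "\<exists>q \<in> one_plus_V (n - 1). q (n - 1) = f \<and> witt_u_product n q"
proof -
  note char = of_nat_CARD_fls[where 'a = 'k, unfolded card]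
  have "\<forall>m. \<exists>j<p. of_nat j = f $$ m"
    using prime_field_of_nat[where 'a = 'k] prime_p card by simp
  then obtain e where e: "\<And>m. e m < p" "\<And>m. of_nat (e m) = f $$ m"
    by metis
  let ?b = "fls_subdegree f" and ?v = "\<lambda>m. witt_u p m n [^]\<^bsub>W\<^esub> e m :: nat \<Rightarrow> 'k fls"
  have u: "witt_u p m n \<in> one_plus_V (n - 1)" for m
    using n by (simp add: witt_u_eq one_plus_V_def)
  have "?v m (n - 1) = of_nat (e m) * witt_u p m n (n - 1)" for m
    using n by (intro one_plus_V_nat_pow_nth[OF char _ u]) simp
  moreover have "witt_u p m n (n - 1) = (fls_X powi m :: 'k fls)" for m
    using n by (simp add: witt_u_eq)
  moreover have "of_nat (e m) = fls_const (f $$ m)" for m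
    by (simp add: fls_of_nat e(2))
  ultimately have "?v m (n - 1) = fls_const (f $$ m) * fls_X powi m" for m
    by simp
  then have "((\<lambda>F. \<Sum>m\<in>F. ?v m (n - 1)) \<longlongrightarrow> f) (finite_subsets_at_top {?b..})"
    using tendsto_fls_monomial_sum[of ?b f] by simp
  from witt_has_prod_one_plus_V[OF char tends_to_one_witt_u_power[OF n] _ _ this] n
    one_plus_V_nat_pow[OF u]
  obtain q where "q \<in> one_plus_V (n - 1)" "q (n - 1) = f" "witt_has_prod p ?v {?b..} q"
    by auto
  moreover have "e m \<in> {0..p - 1}" for m
    using e(1)[of m] by simp
  ultimately show ?thesis
    by (auto simp: witt_u_product_def)
qed

lemma one_plus_V_witt_u_quotient:
  fixes r :: "nat \<Rightarrow> 'k::{field,finite} fls"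
  assumes card: "CARD('k) = p" and n: "2 \<le> n" and r: "r \<in> one_plus_V (n - 1)"
  shows "\<exists>q \<in> one_plus_V (n - 1). \<exists>s \<in> one_plus_V n. witt_u_product n q \<and> r = q \<otimes>\<^bsub>W\<^esub> s"
proof -
  note char = of_nat_CARD_fls[where 'a = 'k, unfolded card]
  obtain q where q: "q \<in> one_plus_V (n - 1)" "q (n - 1) = r (n - 1)" "witt_u_product n q"
    using ex_witt_u_product_nth[OF card n] by blast
  obtain s where "s \<in> one_plus_V (Suc (n - 1))" "r = q \<otimes>\<^bsub>W\<^esub> s"
    using one_plus_V_Suc_quotient[OF char _ q(1) r q(2)] n by auto
  with q n show ?thesis
    by auto
qed

lemma witt_has_prod_telescope:
  fixes q r :: "nat \<Rightarrow> nat \<Rightarrow> 'k::field fls"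
  assumes char: "of_nat p = (0 :: 'k fls)" and a: "2 \<le> a"
    and q: "\<And>n. a \<le> n \<Longrightarrow> q n \<in> one_plus_V (n - 1)"
    and r: "\<And>n. a \<le> n \<Longrightarrow> r n \<in> one_plus_V (n - 1)"
    and r_eq: "\<And>n. a \<le> n \<Longrightarrow> r n = q n \<otimes>\<^bsub>W\<^esub> r (Suc n)"
  shows "witt_has_prod p q {a..} (r a)"
proof -
  have partial: "finprod W q {a..<n} \<otimes>\<^bsub>W\<^esub> r n = r a" if "a \<le> n" for n
    using that
  proof (induction n rule: dec_induct)
    case (step n)
    have "finprod W q {a..<Suc n} = finprod W q {a..<n} \<otimes>\<^bsub>W\<^esub> q n"
      using step.hyps by (simp add: atLeastLessThanSuc m_comm)
    with step show ?case
      using r_eq[of n] by (simp add: m_assoc)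
  qed simp
  have "((\<lambda>F. finprod W q F n) \<longlongrightarrow> r a n) (finite_subsets_at_top {a..})" for n
  proof (rule tendsto_eventually, unfold eventually_finite_subsets_at_top,
      intro exI[of _ "{a..<n + a}"] conjI allI impI)
    let ?X = "{a..<n + a}"
    fix F assume F: "finite F \<and> ?X \<subseteq> F \<and> F \<subseteq> {a..}"
    have "q i \<in> one_plus_V (Suc n)" if "i \<in> F - ?X" for i
    proof (rule subsetD[OF one_plus_V_antimono q])
      show "Suc n \<le> i - 1" "a \<le> i"
        using that F a by auto
    qed
    then have "finprod W q F n = finprod W q ?X n"
      using F by (intro finprod_nth_eq_subset) auto
    also have "r (n + a) \<in> one_plus_V (Suc n)"
      using a by (intro subsetD[OF one_plus_V_antimono r]) auto
    then have "finprod W q ?X n = (finprod W q ?X \<otimes>\<^bsub>W\<^esub> r (n + a)) n"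
      by (simp add: witt_mult_nth_eq_left)
    finally show "finprod W q F n = r a n"
      by (simp only: partial le_add2)
  qed auto
  moreover have "one_plus_V (n - 1) \<subseteq> (Units W :: (nat \<Rightarrow> 'k fls) set)" if "a \<le> n" for n
    using that a by (intro one_plus_V_subset_Units[OF char]) simp
  then have "q ` {a..} \<subseteq> Units W" "r a \<in> Units W"
    using q r by blast+
  ultimately show ?thesis
    by (simp add: witt_has_prod_iff finprod_tendsto_def)
qed

lemma one_plus_V_witt_u_expansion:
  fixes y :: "nat \<Rightarrow> 'k::{field,finite} fls"
  assumes card: "CARD('k) = p" and y: "y \<in> one_plus_V 1"
  shows "\<exists>Q. (\<forall>n\<ge>2. witt_u_product n (Q n)) \<and> witt_has_prod p Q {2..} y"
proof -
  note char = of_nat_CARD_fls[where 'a = 'k, unfolded card]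
  have "\<exists>R. \<forall>n. (R n \<in> one_plus_V (Suc n) \<and> (n = 0 \<longrightarrow> R n = y)) \<and>
      (\<exists>q \<in> one_plus_V (Suc n). witt_u_product (n + 2) q \<and> R n = q \<otimes>\<^bsub>W\<^esub> R (Suc n))"
  proof (rule dependent_nat_choice)
    fix r :: "nat \<Rightarrow> 'k fls" and n
    assume "r \<in> one_plus_V (Suc n) \<and> (n = 0 \<longrightarrow> r = y)"
    then show "\<exists>s. (s \<in> one_plus_V (Suc (Suc n)) \<and> (Suc n = 0 \<longrightarrow> s = y)) \<and>
        (\<exists>q \<in> one_plus_V (Suc n). witt_u_product (n + 2) q \<and> r = q \<otimes>\<^bsub>W\<^esub> s)"
      using one_plus_V_witt_u_quotient[OF card, of "n + 2" r] by auto
  qed (use y in auto)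
  then obtain R q where R: "\<And>n. R n \<in> one_plus_V (Suc n)" "R 0 = y"
    and q: "\<And>n. q n \<in> one_plus_V (Suc n)" "\<And>n. witt_u_product (n + 2) (q n)"
    and step: "\<And>n. R n = q n \<otimes>\<^bsub>W\<^esub> R (Suc n)"
    by metis
  have index: "Suc (n - 2) = n - 1" "n - 2 + 2 = n" if "2 \<le> n" for n :: nat
    using that by auto
  have "witt_has_prod p (\<lambda>n. q (n - 2)) {2..} (R (2 - 2))"
  proof (rule witt_has_prod_telescope[OF char order_refl, where r = "\<lambda>n. R (n - 2)"])
    fix n :: nat assume n: "2 \<le> n"
    show "q (n - 2) \<in> one_plus_V (n - 1)" "R (n - 2) \<in> one_plus_V (n - 1)"
      using q(1)[of "n - 2"] R(1)[of "n - 2"] by (simp_all only: index[OF n])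
    show "R (n - 2) = q (n - 2) \<otimes>\<^bsub>W\<^esub> R (Suc n - 2)"
      using step[of "n - 2"] n by (simp only: index Suc_diff_le)
  qed
  moreover have "witt_u_product n (q (n - 2))" if "2 \<le> n" for n
    using q(2)[of "n - 2"] by (simp only: index[OF that])
  ultimately show ?thesis
    using R(2) by (intro exI[of _ "\<lambda>n. q (n - 2)"]) simp
qed

lemma witt_unit_eq_teichmueller_mult:
  fixes x :: "nat \<Rightarrow> 'a::comm_ring_1"
  assumes char: "of_nat p = (0 :: 'a)" and x: "x 0 dvd 1"
  shows "\<exists>y \<in> one_plus_V 1. x = teichmueller (x 0) \<otimes>\<^bsub>W\<^esub> y"
proof -
  obtain y where y: "teichmueller (x 0) \<otimes>\<^bsub>W\<^esub> y = x"
    using ex_witt_mult_eq[OF char, of "teichmueller (x 0)" x] x by (auto simp: teichmueller_def)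
  have "x 0 * y 0 = x 0"
    using fun_cong[OF y, of 0] by (simp add: witt_mult_nth_0 teichmueller_def)
  obtain u where u: "x 0 * u = 1"
    using x by (metis dvdE)
  have "y 0 = x 0 * u * y 0"
    by (simp add: u)
  also have "\<dots> = x 0 * y 0 * u"
    by (simp add: mult_ac)
  also have "\<dots> = 1"
    by (simp only: \<open>x 0 * y 0 = x 0\<close> u)
  finally have "y 0 = 1" .
  with y show ?thesis
    by (auto simp: one_plus_V_def witt_one_nth)
qed

end

theorem theorem3p2:
  fixes p :: nat and x :: "nat \<Rightarrow> 'k::{field,finite} fls"
  assumes "prime p" and "CARD('k) = p"
    and "x \<in> Units (witt_ring p)"
  shows "\<exists>(c :: 'k) (cc :: nat \<Rightarrow> nat \<Rightarrow> 'k) (e :: int \<Rightarrow> nat \<Rightarrow> nat) (b :: nat \<Rightarrow> int) P A Q B.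
    c \<noteq> 0 \<and>
    (\<forall>i2\<ge>2. \<forall>i1\<ge>b i2. e i1 i2 \<in> {0..p - 1}) \<and>
    (\<forall>k. witt_has_prod p
       (\<lambda>j. teichmueller (1 - fls_const (cc j k) * fls_X ^ j) [^]\<^bsub>witt_ring p\<^esub> (p ^ k))
       {j. 0 < j \<and> coprime j p} (P k)) \<and>
    witt_has_prod p P {0..} A \<and>
    (\<forall>i2\<ge>2. witt_has_prod p
       (\<lambda>i1. witt_u p i1 i2 [^]\<^bsub>witt_ring p\<^esub> e i1 i2) {b i2..} (Q i2)) \<and>
    witt_has_prod p Q {2..} B \<and>
    x = teichmueller (fls_const c * fls_X powi fls_subdegree (x 0))
          \<otimes>\<^bsub>witt_ring p\<^esub> A \<otimes>\<^bsub>witt_ring p\<^esub> B"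
proof -
  interpret witt_vectors p
    by unfold_locales fact
  note char = of_nat_CARD_fls[where 'a = 'k, unfolded assms(2)]
  have x0: "x 0 dvd 1" "x 0 \<noteq> 0"
    using assms(3) by (auto simp: Units_witt_ring_iff[OF char])
  obtain y where y: "y \<in> one_plus_V 1" "x = teichmueller (x 0) \<otimes>\<^bsub>W\<^esub> y"
    using witt_unit_eq_teichmueller_mult[OF char, of x] x0(1) by blast
  obtain c g where c: "c \<noteq> 0" and x0_eq: "x 0 = fls_const c * fls_X powi fls_subdegree (x 0) * g"
    and g: "fls_icong 1 g 1"
    by (rule fls_eq_const_X_power_principal_unit[OF x0(2)])
  obtain cc P where P: "\<And>k. witt_has_prod p
       (\<lambda>j. teichmueller (1 - fls_const (cc j k) * fls_X ^ j) [^]\<^bsub>W\<^esub> (p ^ k))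
       {j. 0 < j \<and> coprime j p} (P k)" "witt_has_prod p P {0..} (teichmueller g)"
    by (rule teichmueller_principal_unit_expansion[OF assms(2) g]) blast
  obtain Q where Q: "\<forall>n\<ge>2. witt_u_product n (Q n)" "witt_has_prod p Q {2..} y"
    using one_plus_V_witt_u_expansion[OF assms(2) y(1)] by blast
  obtain e b where e: "\<And>n m. 2 \<le> n \<Longrightarrow> e n m \<in> {0..p - 1}"
    "\<And>n. 2 \<le> n \<Longrightarrow>
      witt_has_prod p (\<lambda>m. witt_u p m n [^]\<^bsub>W\<^esub> (e n m :: nat)) {b n..} (Q n)"
    using Q(1) unfolding witt_u_product_def by metis
  have "x = teichmueller (fls_const c * fls_X powi fls_subdegree (x 0)) \<otimes>\<^bsub>W\<^esub> teichmueller g \<otimes>\<^bsub>W\<^esub> y"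
    using y(2) x0_eq by (simp only: teichmueller_mult)
  with c P Q(2) e show ?thesis
    by (intro exI[of _ c] exI[of _ cc] exI[of _ "\<lambda>m n. e n m"] exI[of _ b] exI[of _ P]
        exI[of _ "teichmueller g"] exI[of _ Q] exI[of _ y] conjI allI impI)
qed

end
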